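(* Let $k\ge1$ and $\pi\in S_k$. (1) If $\pi$ has no peaks, then $g(\pi,n)=\Theta\left((\log n)^{k-1}\right)$ as $n\to\infty$ and $P(\pi,r)=\Theta\left(r(\log r)^{k-1}\right)$ as $r\to\infty$. (2) If $\pi$ has at least one peak, then $g(\pi,n)=O\left((\log n)^{k-2}\right)$ as $n\to\infty$ and $P(\pi,r)=O\left(r(\log r)^{k-2}\right)$ as $r\to\infty$.
   Context: A peak of $\pi\in S_k$ is an index $i$ with $1<i<k$ such that $\pi(i)>\pi(i-1)$ and $\pi(i)>\pi(i+1)$. A $\pi$-wave is an increasing sequence of integers $x_1<\cdots<x_{k+1}$ such that for all $1\le i,j\le k$, $x_{i+1}-x_i > x_{j+1}-x_j$ if and only if $\pi(i)>\pi(j)$. $g(\pi,n)$ is the largest cardinality of a subset of $[n]=\{1,\dots,n\}$ containing no $\pi$-wave. $P(\pi,r)$ is the least positive integer $M$ such that every $r$-coloring of $[M]$ contains a monochromatic $\pi$-wave. Implied constants may depend on $\pi$. *)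

theory Defs
  imports Complex_Main
    "HOL-Combinatorics.Permutations"
    "HOL-Library.Landau_Symbols"
    "HOL-Library.Ramsey"
begin

text \<open>An element of \<open>S\<^sub>k\<close> is a function \<^term>\<open>p :: nat \<Rightarrow> nat\<close> with
  \<^term>\<open>p permutes {1..k}\<close>.\<close>

definition is_peak :: "nat \<Rightarrow> (nat \<Rightarrow> nat) \<Rightarrow> nat \<Rightarrow> bool" where
  "is_peak k \<pi> i \<longleftrightarrow> 1 < i \<and> i < k \<and> \<pi> i > \<pi> (i - 1) \<and> \<pi> i > \<pi> (i + 1)"

text \<open>A finite sequence \<open>x\<^sub>1, \<dots>, x\<^sub>k\<^sub>+\<^sub>1\<close> is a function on \<^typ>\<open>nat\<close> of which only the values
  on \<^term>\<open>{1..k+1}\<close> matter.\<close>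

definition is_wave :: "nat \<Rightarrow> (nat \<Rightarrow> nat) \<Rightarrow> (nat \<Rightarrow> int) \<Rightarrow> bool" where
  "is_wave k \<pi> x \<longleftrightarrow>
     (\<forall>i\<in>{1..k}. x i < x (i + 1)) \<and>
     (\<forall>i\<in>{1..k}. \<forall>j\<in>{1..k}. x (i + 1) - x i > x (j + 1) - x j \<longleftrightarrow> \<pi> i > \<pi> j)"

definition contains_wave :: "nat \<Rightarrow> (nat \<Rightarrow> nat) \<Rightarrow> int set \<Rightarrow> bool" where
  "contains_wave k \<pi> A \<longleftrightarrow> (\<exists>x. is_wave k \<pi> x \<and> x ` {1..k+1} \<subseteq> A)"

definition wave_g :: "nat \<Rightarrow> (nat \<Rightarrow> nat) \<Rightarrow> nat \<Rightarrow> nat" where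
  "wave_g k \<pi> n = Max {card A | A. A \<subseteq> {1..int n} \<and> \<not> contains_wave k \<pi> A}"

definition forces_wave :: "nat \<Rightarrow> (nat \<Rightarrow> nat) \<Rightarrow> nat \<Rightarrow> nat \<Rightarrow> bool" where
  "forces_wave k \<pi> r M \<longleftrightarrow>
     (\<forall>c :: int \<Rightarrow> nat. c ` {1..int M} \<subseteq> {..<r} \<longrightarrow>
        (\<exists>a<r. contains_wave k \<pi> {m \<in> {1..int M}. c m = a}))"

definition wave_P :: "nat \<Rightarrow> (nat \<Rightarrow> nat) \<Rightarrow> nat \<Rightarrow> nat" where
  "wave_P k \<pi> r = (LEAST M. 0 < M \<and> forces_wave k \<pi> r M)"

text \<open>The maximum and the minimum above are attained, so \<^const>\<open>wave_g\<close> and \<^const>\<open>wave_P\<close> never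
  take an unspecified value.\<close>

lemma wave_g_attained:
  "\<exists>A. A \<subseteq> {1..int n} \<and> \<not> contains_wave k \<pi> A \<and> card A = wave_g k \<pi> n"
proof -
  let ?C = "{card A | A. A \<subseteq> {1..int n} \<and> \<not> contains_wave k \<pi> A}"
  have "finite ?C"
    by (rule finite_subset[of _ "card ` Pow {1..int n}"]) auto
  moreover have "card ({}::int set) \<in> ?C"
    unfolding contains_wave_def mem_Collect_eq by (rule exI[of _ "{}"]) auto
  ultimately have "Max ?C \<in> ?C" by (intro Max_in) auto
  then show ?thesis unfolding wave_g_def[symmetric] by auto
qed

text \<open>Existence for \<^const>\<open>wave_P\<close>: colour a \<open>k\<close>-set \<open>S\<close> of exponents by the colour of
  \<open>\<Sum>s\<in>S. 2 ^ s\<close> and apply Ramsey's theorem. In a homogeneous set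
  \<open>h\<^sub>0 < h\<^sub>1 < \<dots>\<close> start from the exponents of even index and replace them
  by their successors in the order prescribed by the permutation.\<close>

lemma ex_forces_wave:
  assumes k: "1 \<le> k" and perm: "\<pi> permutes {1..k}"
  shows "\<exists>M>0. forces_wave k \<pi> r M"
proof -
  obtain N where N: "partn_lst {..<N::nat} (replicate r (2 * k)) k"
    using ramsey_full by blast
  have sum_N: "(\<Sum>s<N. 2 ^ s :: int) = 2 ^ N - 1"
    by (induction N) auto
  have "forces_wave k \<pi> r (2 ^ N)"
    unfolding forces_wave_def
  proof (intro allI impI)
    fix c :: "int \<Rightarrow> nat"
    assume c: "c ` {1..int (2 ^ N)} \<subseteq> {..<r}"
    define \<phi> :: "nat set \<Rightarrow> int" where "\<phi> S = (\<Sum>s\<in>S. 2 ^ s)" for S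
    have \<phi>: "\<phi> S \<in> {1..int (2 ^ N)}" if S: "S \<in> nsets {..<N} k" for S
    proof -
      have S': "S \<subseteq> {..<N}" "finite S" "S \<noteq> {}"
        using S k by (auto simp: nsets_def)
      have "\<phi> S \<le> (\<Sum>s<N. 2 ^ s)"
        unfolding \<phi>_def using S' by (intro sum_mono2) auto
      moreover have "\<phi> S > 0"
        unfolding \<phi>_def using S' by (intro sum_pos) auto
      ultimately show ?thesis using sum_N by auto
    qed
    have "(\<lambda>S. c (\<phi> S)) \<in> nsets {..<N} k \<rightarrow> {..<r}"
      using c \<phi> by blast
    then obtain a H where a: "a < r" and H: "H \<in> nsets {..<N} (2 * k)"
      and hom: "(\<lambda>S. c (\<phi> S)) ` nsets H k \<subseteq> {a}"
      using N unfolding partn_lst_def monochromatic_def by (auto simp del: image_subset_iff)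
    have H': "H \<subseteq> {..<N}" "finite H" "card H = 2 * k"
      using H by (auto simp: nsets_def)
    define h where "h = enumerate H"
    have h_in: "h m \<in> H" if "m < 2 * k" for m
      using H' that unfolding h_def by (simp add: finite_enumerate_in_set)
    have h_less: "h m < h n" if "m < n" "n < 2 * k" for m n
      using H' that unfolding h_def by (simp add: finite_enumerate_mono)
    define e where
      "e j p = h (if inv \<pi> p < j then 2 * p - 1 else 2 * p - 2)" for j p :: nat
    have e_less: "e j p < e j q" if "1 \<le> p" "p < q" "q \<le> k" for j p q
      unfolding e_def using that by (intro h_less) auto
    have inj: "inj_on (e j) {1..k}" for j
      by (rule linorder_inj_onI') (use e_less[of _ _ j] in \<open>fastforce\<close>)
    have e_nsets: "e j ` {1..k} \<in> nsets H k" for j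
    proof -
      have "e j p \<in> H" if "p \<in> {1..k}" for p
        unfolding e_def using that by (intro h_in) auto
      then show ?thesis
        using inj[of j] by (auto simp: nsets_def card_image)
    qed
    define x where "x j = \<phi> (e j ` {1..k})" for j
    have x_sum: "x j = (\<Sum>p\<in>{1..k}. 2 ^ e j p)" for j
      unfolding x_def \<phi>_def using inj[of j] by (simp add: sum.reindex)
    define d :: "nat \<Rightarrow> int" where "d p = 2 ^ h (2 * p - 1) - 2 ^ h (2 * p - 2)" for p
    have gap: "x (i + 1) - x i = d (\<pi> i)" if i: "i \<in> {1..k}" for i
    proof -
      have *: "inv \<pi> p = i \<longleftrightarrow> p = \<pi> i" for p
        using perm permutes_inv_eq by metis
      have "x (i + 1) - x i = (\<Sum>p\<in>{1..k}. 2 ^ e (i + 1) p - 2 ^ e i p)"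
        by (simp only: x_sum sum_subtractf)
      also have "\<dots> = (\<Sum>p\<in>{1..k}. if p = \<pi> i then d p else 0)"
        by (intro sum.cong refl) (auto simp: e_def d_def less_Suc_eq simp flip: *)
      also have "\<dots> = d (\<pi> i)"
        using permutes_in_image[OF perm] i by (simp del: atLeastAtMost_iff)
      finally show ?thesis .
    qed
    have d_pos: "d p > 0" if "p \<in> {1..k}" for p
      unfolding d_def using h_less[of "2 * p - 2" "2 * p - 1"] that by auto
    have d_less: "d p < d q" if "p \<in> {1..k}" "q \<in> {1..k}" "p < q" for p q
    proof -
      let ?u = "h (2 * p - 1)" and ?v = "h (2 * q - 2)" and ?w = "h (2 * q - 1)"
      have "?u < ?v" "?v < ?w" using that by (auto intro!: h_less)
      then have "(2::int) ^ ?u < 2 ^ ?v" "(2::int) ^ Suc ?v \<le> 2 ^ ?w"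
        by (simp, intro power_increasing) auto
      moreover have "(0::int) < 2 ^ h (2 * p - 2)" by simp
      ultimately show ?thesis unfolding d_def power_Suc by linarith
    qed
    have d_iff: "d p > d q \<longleftrightarrow> p > q" if "p \<in> {1..k}" "q \<in> {1..k}" for p q
      using d_less[of p q] d_less[of q p] that by (cases p q rule: linorder_cases) auto
    have \<pi>_in: "\<pi> i \<in> {1..k}" if "i \<in> {1..k}" for i
      using permutes_in_image[OF perm] that by blast
    have "is_wave k \<pi> x"
      unfolding is_wave_def
    proof (intro conjI ballI)
      show "x i < x (i + 1)" if "i \<in> {1..k}" for i
        using gap[OF that] d_pos[OF \<pi>_in[OF that]] by linarith
      show "x (j + 1) - x j < x (i + 1) - x i \<longleftrightarrow> \<pi> j < \<pi> i"
        if "i \<in> {1..k}" "j \<in> {1..k}" for i j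
        unfolding gap[OF that(1)] gap[OF that(2)]
        using that by (intro d_iff \<pi>_in)
    qed
    moreover have "x j \<in> {m \<in> {1..int (2 ^ N)}. c m = a}" for j
    proof -
      have "e j ` {1..k} \<in> nsets {..<N} k"
        using e_nsets[of j] nsets_mono[OF H'(1)] by blast
      moreover have "c (x j) = a"
        using hom e_nsets[of j] unfolding x_def by blast
      ultimately show ?thesis using \<phi> unfolding x_def by simp
    qed
    ultimately show "\<exists>a<r. contains_wave k \<pi> {m \<in> {1..int (2 ^ N)}. c m = a}"
      unfolding contains_wave_def using a by blast
  qed
  then show ?thesis by (intro exI[of _ "2 ^ N"]) simp
qed

end

theory Submission
  imports Defs
begin

text \<open>
  Upper bounds: one looks for waves whose gaps grow by a factor \<open>l\<close> along the order given by \<open>\<pi>\<close>,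
  so that small perturbations of the points are harmless. Cut a set \<open>A \<subseteq> {0..<2 ^ L}\<close> into
  blocks of boundedly many consecutive elements and keep those of a popular dyadic diameter; this
  costs a factor \<open>L\<close>. In a wave for \<open>\<pi>\<close> without its minimum, found among well separated blocks, a
  point can be replaced by two points of its block, which creates the missing smallest gap. A long
  block also contains a gap much smaller than its diameter, so if the two smallest values of \<open>\<pi>\<close>
  are not adjacent, both gaps can be created at the cost of a single factor \<open>L\<close>. Deleting minima
  one by one, such a non-adjacent pair occurs exactly when \<open>\<pi>\<close> has a peak.

  Lower bounds: without a peak, the maximum of \<open>\<pi>\<close> is its first or its last value. Place \<open>m\<close>
  translates of a set that is wave-free for the rest of \<open>\<pi>\<close> at geometrically growing, respectively
  shrinking, distances: an extremal gap at that end is too short once a wave leaves a block.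
  Each element can be given a prescribed residue modulo \<open>q = m ^ (k - 1)\<close>; then translates by
  multiples of \<open>q\<close> cover an interval efficiently, which bounds the number of colours.
\<close>

section \<open>Lacunary waves and upper bounds\<close>

text \<open>The factor \<open>l\<close> is slack: changing each gap by at most a factor 2 turns
  \<open>4 * l\<close> into \<open>l\<close>, so the order of the gaps survives. At the end
  \<open>l = 2\<close> suffices, since gaps are positive.\<close>

definition lacunary_wave :: "nat \<Rightarrow> (nat \<Rightarrow> nat) \<Rightarrow> int \<Rightarrow> (nat \<Rightarrow> int) \<Rightarrow> bool" where
  "lacunary_wave k \<pi> l x \<longleftrightarrow>
     (\<forall>i\<in>{1..k}. x i < x (i + 1)) \<and>
     (\<forall>i\<in>{1..k}. \<forall>j\<in>{1..k}. \<pi> j < \<pi> i \<longrightarrow> l * (x (j + 1) - x j) \<le> x (i + 1) - x i)"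

lemma lacunary_wave_is_wave:
  assumes "lacunary_wave k \<pi> 2 x" "inj_on \<pi> {1..k}"
  shows "is_wave k \<pi> x"
  unfolding is_wave_def
proof (intro conjI ballI)
  have pos: "x i < x (i + 1)" if "i \<in> {1..k}" for i
    using assms(1) that unfolding lacunary_wave_def by blast
  then show "x i < x (i + 1)" if "i \<in> {1..k}" for i using that .
  have gap_less: "x (j + 1) - x j < x (i + 1) - x i"
    if "i \<in> {1..k}" "j \<in> {1..k}" "\<pi> j < \<pi> i" for i j
  proof -
    have "2 * (x (j + 1) - x j) \<le> x (i + 1) - x i"
      using assms(1) that unfolding lacunary_wave_def by blast
    then show ?thesis using pos[OF that(2)] by (simp add: algebra_simps)
  qed
  show "x (j + 1) - x j < x (i + 1) - x i \<longleftrightarrow> \<pi> j < \<pi> i" if "i \<in> {1..k}" "j \<in> {1..k}" for i j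
  proof (cases "\<pi> i" "\<pi> j" rule: linorder_cases)
    case less
    then show ?thesis using gap_less[of j i] that by simp
  next
    case equal
    then have "i = j" using assms(2) that by (auto dest: inj_onD)
    then show ?thesis by simp
  next
    case greater
    then show ?thesis using gap_less[of i j] that by simp
  qed
qed

section \<open>Creating a new smallest gap by splitting one point of a wave in two\<close>

text \<open>The increasing enumeration of the indices other than \<open>p\<close>, so
  \<open>\<pi> \<circ> skip p\<close> is \<pi> with its value at \<open>p\<close> deleted. Values
  are not renumbered; therefore the inductions assume injectivity only, not a permutation.\<close>

definition skip :: "nat \<Rightarrow> nat \<Rightarrow> nat" where
  "skip p j = (if j < p then j else j + 1)"

text \<open>The point \<open>x p\<close> gives way to the two points \<open>y\<close>,
  \<open>z\<close>. The new gap has index \<open>p\<close>, and the old gap \<open>j\<close> becomes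
  the gap \<open>skip p j\<close>.\<close>

definition insert_pair :: "(nat \<Rightarrow> int) \<Rightarrow> nat \<Rightarrow> int \<Rightarrow> int \<Rightarrow> nat \<Rightarrow> int" where
  "insert_pair x p y z j = (if j < p then x j else if j = p then y else if j = p + 1 then z else x (j - 1))"

lemma skip_in: "j \<in> {1..k} \<Longrightarrow> skip p j \<in> {1..k + 1}"
  by (auto simp: skip_def)

lemma inj_skip: "inj_on (skip p) S"
  by (auto simp: skip_def inj_on_def split: if_splits)

lemma inj_on_comp_skip: "inj_on \<pi> {1..k + 1} \<Longrightarrow> inj_on (\<pi> \<circ> skip p) {1..k}"
  by (rule comp_inj_on[OF inj_skip], erule inj_on_subset) (use skip_in in blast)

lemma skip_cases:
  assumes "i \<in> {1..k + 1}" "i \<noteq> p" "p \<in> {1..k + 1}"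
  obtains j where "j \<in> {1..k}" "i = skip p j"
proof (cases "i < p")
  case True
  then show ?thesis using assms that[of i] by (auto simp: skip_def)
next
  case False
  then have "i - 1 \<in> {1..k}" "i = skip p (i - 1)" using assms by (auto simp: skip_def)
  then show ?thesis using that by blast
qed

text \<open>Only the two gaps that meet at \<open>x p\<close> change: the left one grows and the
  right one shrinks, each by at most \<open>D\<close>, which is at most half of the gap.\<close>

lemma insert_pair_gap:
  fixes x :: "nat \<Rightarrow> int"
  assumes j: "j \<in> {1..k}" and yz: "x p \<le> y" "y < z" "z \<le> x p + D"
    and adj: "j = p \<or> j + 1 = p \<Longrightarrow> 2 * D \<le> x (j + 1) - x j"
    and pos: "x j < x (j + 1)"
  defines "G \<equiv> insert_pair x p y z (skip p j + 1) - insert_pair x p y z (skip p j)"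
  shows "x (j + 1) - x j \<le> 2 * G" "G \<le> 2 * (x (j + 1) - x j)"
proof -
  consider "j + 1 < p" | "j + 1 = p" | "j = p" | "j > p" by linarith
  then have "x (j + 1) - x j \<le> 2 * G \<and> G \<le> 2 * (x (j + 1) - x j)"
  proof cases
    case 1
    then show ?thesis using pos by (simp add: G_def insert_pair_def skip_def)
  next
    case 2
    then have "G = y - x j" "x p = x (j + 1)" by (auto simp: G_def insert_pair_def skip_def)
    then show ?thesis using yz pos adj 2 by simp
  next
    case 3
    then have "G = x (j + 1) - z" "x p = x j" by (auto simp: G_def insert_pair_def skip_def)
    then show ?thesis using yz pos adj 3 by simp
  next
    case 4
    then show ?thesis using pos by (simp add: G_def insert_pair_def skip_def)
  qed
  then show "x (j + 1) - x j \<le> 2 * G" "G \<le> 2 * (x (j + 1) - x j)" by blast+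
qed

text \<open>Two old gaps may each lose a factor 2 in their ratio, hence \<open>4 * l\<close>. The
  displacement bound \<open>D\<close> and the new gap \<open>z - y\<close> are kept apart: in the
  second insertion of \<open>unavoidable_insert_two\<close> some gap away from \<open>p\<close> is
  smaller than \<open>2 * D\<close>, yet still large compared with \<open>z - y\<close>.\<close>

lemma lacunary_wave_insert:
  assumes w: "lacunary_wave k (\<pi> \<circ> skip p) (4 * l) x" and l: "1 \<le> l"
    and p: "p \<in> {1..k + 1}"
    and min: "\<And>i. i \<in> {1..k + 1} \<Longrightarrow> i \<noteq> p \<Longrightarrow> \<pi> p < \<pi> i"
    and yz: "x p \<le> y" "y < z" "z \<le> x p + D"
    and adj: "\<And>i. i \<in> {1..k} \<Longrightarrow> i = p \<or> i + 1 = p \<Longrightarrow> 2 * D \<le> x (i + 1) - x i"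
    and small: "\<And>i. i \<in> {1..k} \<Longrightarrow> 2 * l * (z - y) \<le> x (i + 1) - x i"
  shows "lacunary_wave (k + 1) \<pi> l (insert_pair x p y z)"
proof -
  let ?x = "insert_pair x p y z"
  let ?G = "\<lambda>i. ?x (i + 1) - ?x i" and ?g = "\<lambda>i. x (i + 1) - x i"
  have pos: "x i < x (i + 1)" if "i \<in> {1..k}" for i
    using w that unfolding lacunary_wave_def by blast
  have Gp: "?G p = z - y" by (simp add: insert_pair_def)
  have gap: "?g j \<le> 2 * ?G (skip p j)" "?G (skip p j) \<le> 2 * ?g j" if "j \<in> {1..k}" for j
    using insert_pair_gap[OF that yz adj pos] that by auto
  show ?thesis
    unfolding lacunary_wave_def
  proof (intro conjI ballI impI)
    fix i assume i: "i \<in> {1..k + 1}"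
    show "?x i < ?x (i + 1)"
    proof (cases "i = p")
      case True
      then show ?thesis using Gp yz by simp
    next
      case False
      then obtain j where "j \<in> {1..k}" "i = skip p j" by (rule skip_cases[OF i _ p])
      then show ?thesis using gap(1)[of j] pos[of j] by simp
    qed
  next
    fix i j assume ij: "i \<in> {1..k + 1}" "j \<in> {1..k + 1}" "\<pi> j < \<pi> i"
    have "i \<noteq> p" using min[of j] ij by fastforce
    then obtain i' where i': "i' \<in> {1..k}" "i = skip p i'" by (rule skip_cases[OF ij(1) _ p])
    show "l * ?G j \<le> ?G i"
    proof (cases "j = p")
      case True
      then show ?thesis using Gp gap(1)[OF i'(1)] small[OF i'(1)] i'(2) by simp
    next
      case False
      then obtain j' where j': "j' \<in> {1..k}" "j = skip p j'" by (rule skip_cases[OF ij(2) _ p])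
      have "4 * l * ?g j' \<le> ?g i'"
        using w i' j' ij(3) unfolding lacunary_wave_def by auto
      moreover have "l * ?G j \<le> l * (2 * ?g j')"
        using gap(2)[OF j'(1)] j'(2) l by (intro mult_left_mono) auto
      ultimately show ?thesis using gap(1)[OF i'(1)] i'(2) by (simp add: algebra_simps)
    qed
  qed
qed

lemma insert_pair_image:
  assumes "x ` {1..k + 1} \<subseteq> A" "y \<in> A" "z \<in> A" "p \<in> {1..k + 1}"
  shows "insert_pair x p y z ` {1..k + 2} \<subseteq> A"
proof -
  have x: "x i \<in> A" if "1 \<le> i" "i \<le> k + 1" for i
    using assms(1) that by (auto simp: image_subset_iff)
  show ?thesis
    using assms(2-4) by (auto simp: insert_pair_def intro!: x)
qed

section \<open>Well separated clusters of one dyadic scale in a dense set\<close>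

lemma gaps_add:
  fixes f :: "nat \<Rightarrow> int"
  assumes "\<And>i. i + 1 < n \<Longrightarrow> f i + \<delta> \<le> f (i + 1)" "i + m < n"
  shows "f i + int m * \<delta> \<le> f (i + m)"
  using assms(2)
proof (induction m)
  case (Suc m)
  then show ?case using assms(1)[of "i + m"] by (simp add: algebra_simps)
qed simp

lemma increasing_enumeration:
  fixes S :: "'a::linorder set"
  assumes "finite S"
  shows "\<exists>f. bij_betw f {..<card S} S \<and> strict_mono_on {..<card S} f"
proof (intro exI conjI)
  show "bij_betw ((!) (sorted_list_of_set S)) {..<card S} S"
    by (rule bij_betw_nth) (use assms in auto)
  show "strict_mono_on {..<card S} ((!) (sorted_list_of_set S))"
    by (auto simp: strict_mono_on_def intro: sorted_wrt_nth_less[OF strict_sorted_list_of_set])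
qed

text \<open>Keep every \<open>K\<close>-th element of the increasing enumeration; consecutive
  survivors are then \<open>K\<close> steps of size at least \<delta> apart.\<close>

lemma thin_out:
  fixes S :: "int set"
  assumes S: "finite S" "K * N \<le> card S" and K: "1 \<le> K" and \<delta>: "0 \<le> \<delta>"
    and sp: "\<And>a b. a \<in> S \<Longrightarrow> b \<in> S \<Longrightarrow> a < b \<Longrightarrow> a + \<delta> \<le> b"
  shows "\<exists>S'\<subseteq>S. card S' = N \<and> (\<forall>a\<in>S'. \<forall>b\<in>S'. a < b \<longrightarrow> a + int K * \<delta> \<le> b)"
proof -
  obtain f where f: "bij_betw f {..<card S} S" "strict_mono_on {..<card S} f"
    using increasing_enumeration[OF S(1)] by blast
  have inS: "f i \<in> S" if "i < card S" for i
    using f(1) that by (auto simp: bij_betw_def)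
  have mono: "f i < f j" if "i < j" "j < card S" for i j
    using f(2) that by (auto simp: strict_mono_on_def)
  have lt: "K * i < card S" if "i < N" for i
  proof -
    have "K * i < K * N" using that K by simp
    then show ?thesis using S(2) by linarith
  qed
  have inj: "inj_on (\<lambda>i. f (K * i)) {..<N}"
  proof (rule linorder_inj_onI')
    fix i j assume "i \<in> {..<N}" "j \<in> {..<N}" "i < j"
    then show "f (K * i) \<noteq> f (K * j)" using mono[of "K * i" "K * j"] lt[of j] K by simp
  qed
  show ?thesis
  proof (intro exI[of _ "(\<lambda>i. f (K * i)) ` {..<N}"] conjI ballI impI)
    show "(\<lambda>i. f (K * i)) ` {..<N} \<subseteq> S" using inS lt by auto
    show "card ((\<lambda>i. f (K * i)) ` {..<N}) = N" using inj by (simp add: card_image)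
    fix a b assume "a \<in> (\<lambda>i. f (K * i)) ` {..<N}" "b \<in> (\<lambda>i. f (K * i)) ` {..<N}" "a < b"
    then obtain i j where ij: "i < N" "j < N" "a = f (K * i)" "b = f (K * j)" by auto
    have "i < j"
    proof (rule ccontr)
      assume "\<not> i < j"
      then have "K * j \<le> K * i" by simp
      then show False using mono[of "K * j" "K * i"] lt[OF ij(1)] \<open>a < b\<close> ij
        by (cases "K * j = K * i") auto
    qed
    then obtain d where d: "j = i + Suc d" using less_imp_Suc_add by auto
    have step: "f i + \<delta> \<le> f (i + 1)" if "i + 1 < card S" for i
      using that inS mono by (intro sp) auto
    have "f (K * i) + int (K * Suc d) * \<delta> \<le> f (K * i + K * Suc d)"
      by (rule gaps_add[where n = "card S"]) (use step lt[OF ij(2)] d in \<open>auto simp: algebra_simps\<close>)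
    moreover have "int K * \<delta> \<le> int (K * Suc d) * \<delta>"
      using \<delta> K by (intro mult_right_mono) auto
    ultimately show "a + int K * \<delta> \<le> b" using ij d by (simp add: algebra_simps)
  qed
qed

text \<open>The smallest of \<open>B\<close> consecutive gaps is at most their average.\<close>

lemma small_gap:
  fixes f :: "nat \<Rightarrow> int"
  assumes "1 \<le> B"
  shows "\<exists>i<B. int B * (f (c + i + 1) - f (c + i)) \<le> f (c + B) - f c"
proof (rule ccontr)
  assume "\<not> ?thesis"
  \<comment> \<open>Strictness over the integers is recorded as \<open>+ 1\<close>, which makes the
    telescoping sum contradictory.\<close>
  then have *: "int B * (f (c + i + 1) - f (c + i)) \<ge> f (c + B) - f c + 1" if "i < B" for i
    using that by (meson not_le zless_imp_add1_zle)
  have "(\<Sum>i<B. f (c + B) - f c + 1) \<le> (\<Sum>i<B. int B * (f (c + i + 1) - f (c + i)))"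
    by (intro sum_mono *) auto
  also have "\<dots> = int B * (f (c + B) - f c)"
    using sum_lessThan_telescope[of "\<lambda>i. f (c + i)" B] by (simp flip: sum_distrib_left)
  finally show False using assms by (simp add: algebra_simps)
qed

lemma dyadic_scale:
  assumes "0 < d" "d < (2::int) ^ L"
  shows "\<exists>s<L. 2 ^ s \<le> d \<and> d < 2 ^ (s + 1)"
  using assms
proof (induction L)
  case (Suc L)
  then show ?case
    by (cases "d < 2 ^ L") (auto simp: less_Suc_eq)
qed simp

lemma pigeonhole_classes:
  fixes \<sigma> :: "nat \<Rightarrow> nat"
  assumes "\<And>t. t < L * N \<Longrightarrow> \<sigma> t < L" "1 \<le> L"
  shows "\<exists>s<L. N \<le> card {t. t < L * N \<and> \<sigma> t = s}"
proof (rule ccontr)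
  assume *: "\<not> ?thesis"
  have N: "N > 0" using * assms(2) by (metis le0 less_eq_Suc_le not_gr0 One_nat_def)
  have "card (\<Union>s<L. {t. t < L * N \<and> \<sigma> t = s}) \<le> (\<Sum>s<L. card {t. t < L * N \<and> \<sigma> t = s})"
    by (rule card_UN_le) simp
  also have "\<dots> \<le> (\<Sum>s<L. N - 1)"
    using * N by (intro sum_mono) (force simp: not_le)
  finally have "card (\<Union>s<L. {t. t < L * N \<and> \<sigma> t = s}) \<le> L * (N - 1)" by simp
  moreover have "(\<Union>s<L. {t. t < L * N \<and> \<sigma> t = s}) = {..<L * N}"
    using assms(1) by auto
  ultimately have "L * N \<le> L * (N - 1)" by simp
  then show False using N assms(2) by simp
qed

text \<open>Blocks of \<open>B + 1\<close> consecutive elements have diameters in one of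
  \<open>L\<close> dyadic classes, so some class holds \<open>K * N\<close> blocks.
  \<open>A'\<close> consists of the first elements of every \<open>K\<close>-th of these. The
  factors \<open>B + 1\<close>, \<open>L\<close> and \<open>K\<close> of the hypothesis pay for the
  blocks, the choice of class and the thinning.\<close>

lemma clusters:
  fixes A :: "int set"
  assumes A: "A \<subseteq> {0..<2 ^ L}" and B: "1 \<le> B" and K: "1 \<le> K" and L: "1 \<le> L"
    and card: "(B + 1) * (L * (K * N)) \<le> card A"
  shows "\<exists>s A'. A' \<subseteq> A \<and> card A' = N \<and>
    (\<forall>a\<in>A'. \<exists>b\<in>A. 2 ^ s \<le> b - a \<and> b - a < 2 ^ (s + 1) \<and>
       (\<exists>y\<in>A. \<exists>z\<in>A. a \<le> y \<and> y < z \<and> z \<le> b \<and> int B * (z - y) \<le> b - a)) \<and>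
    (\<forall>a\<in>A'. \<forall>a'\<in>A'. a < a' \<longrightarrow> a + int K * 2 ^ s \<le> a')"
proof -
  have fin: "finite A" using A finite_subset by blast
  obtain f where f: "bij_betw f {..<card A} A" "strict_mono_on {..<card A} f"
    using increasing_enumeration[OF fin] by blast
  have inA: "f i \<in> A" if "i < card A" for i
    using f(1) that by (auto simp: bij_betw_def)
  have mono: "f i < f j" if "i < j" "j < card A" for i j
    using f(2) that by (auto simp: strict_mono_on_def)
  let ?T = "L * (K * N)"
  \<comment> \<open>The ends of block \<open>t\<close>, which spans \<open>B\<close> consecutive
    gaps of the enumeration.\<close>
  define a where "a t = f ((B + 1) * t)" for t
  define b where "b t = f ((B + 1) * t + B)" for t
  have lt: "(B + 1) * t + B < card A" if "t < ?T" for t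
  proof -
    have "(B + 1) * Suc t \<le> (B + 1) * ?T" using that by (intro mult_le_mono) auto
    then show ?thesis using card by simp
  qed
  have ab: "a t < b t" "a t \<in> A" "b t \<in> A" if "t < ?T" for t
    using lt[OF that] B unfolding a_def b_def by (auto intro!: mono inA)
  have "\<exists>s<L. 2 ^ s \<le> b t - a t \<and> b t - a t < 2 ^ (s + 1)" if "t < ?T" for t
    using ab[OF that] A by (intro dyadic_scale) (auto dest!: subsetD[OF A])
  then obtain \<sigma> where \<sigma>: "\<And>t. t < ?T \<Longrightarrow> \<sigma> t < L \<and> 2 ^ \<sigma> t \<le> b t - a t \<and> b t - a t < 2 ^ (\<sigma> t + 1)"
    by metis
  obtain s where s: "s < L" "K * N \<le> card {t. t < ?T \<and> \<sigma> t = s}"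
    using pigeonhole_classes[of L "K * N" \<sigma>] \<sigma> L by blast
  define T where "T = {t. t < ?T \<and> \<sigma> t = s}"
  have sep: "b t < a t'" if "t < t'" "t' < ?T" for t t'
  proof -
    have "(B + 1) * Suc t \<le> (B + 1) * t'" using that by (intro mult_le_mono) auto
    then show ?thesis
      unfolding a_def b_def using lt[OF that(2)] by (intro mono) auto
  qed
  have inj: "inj_on a T"
  proof (rule linorder_inj_onI')
    fix t t' assume "t \<in> T" "t' \<in> T" "t < t'"
    then show "a t \<noteq> a t'" using sep[of t t'] ab(1)[of t] unfolding T_def by auto
  qed
  have "\<exists>S'\<subseteq>a ` T. card S' = N \<and> (\<forall>u\<in>S'. \<forall>v\<in>S'. u < v \<longrightarrow> u + int K * 2 ^ s \<le> v)"
  proof (rule thin_out[OF _ _ K])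
    show "finite (a ` T)" by (auto simp: T_def)
    show "K * N \<le> card (a ` T)" using s inj by (simp add: card_image T_def)
    fix u v assume uv: "u \<in> a ` T" "v \<in> a ` T" "u < v"
    then obtain t t' where t: "t < ?T" "t' < ?T" "\<sigma> t = s" "u = a t" "v = a t'"
      by (auto simp: T_def)
    have "t < t'"
    proof (rule ccontr)
      assume "\<not> t < t'"
      then show False using sep[of t' t] ab(1)[of t'] t uv(3) by (cases "t = t'") auto
    qed
    \<comment> \<open>The earlier block has diameter at least \<open>2 ^ s\<close> and ends before
      the later one starts.\<close>
    then show "u + 2 ^ s \<le> v" using sep[of t t'] \<sigma>[of t] t by auto
  qed simp
  then obtain S' where S': "S' \<subseteq> a ` T" "card S' = N"
    "\<forall>u\<in>S'. \<forall>v\<in>S'. u < v \<longrightarrow> u + int K * 2 ^ s \<le> v" by blast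
  show ?thesis
  proof (intro exI[of _ s] exI[of _ S'] conjI ballI)
    show "S' \<subseteq> A" using S'(1) ab(2) by (auto simp: T_def)
    show "card S' = N" by fact
    fix u assume "u \<in> S'"
    then obtain t where t: "t < ?T" "\<sigma> t = s" "u = a t" using S'(1) by (auto simp: T_def)
    obtain i where i: "i < B" "int B * (f ((B + 1) * t + i + 1) - f ((B + 1) * t + i)) \<le> b t - a t"
      using small_gap[OF B, of f "(B + 1) * t"] unfolding a_def b_def by blast
    have le: "f ((B + 1) * t) \<le> f ((B + 1) * t + i)"
      using mono[of "(B + 1) * t" "(B + 1) * t + i"] lt[OF t(1)] i(1) by (cases "i = 0") auto
    have le': "f ((B + 1) * t + i + 1) \<le> f ((B + 1) * t + B)"
      using mono[of "(B + 1) * t + i + 1" "(B + 1) * t + B"] lt[OF t(1)] i(1)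
      by (cases "i + 1 = B") auto
    have "\<exists>y\<in>A. \<exists>z\<in>A. a t \<le> y \<and> y < z \<and> z \<le> b t \<and> int B * (z - y) \<le> b t - a t"
      using i(2) le le' lt[OF t(1)] i(1) unfolding a_def b_def
      by (intro bexI[of _ "f ((B + 1) * t + i)"] bexI[of _ "f ((B + 1) * t + i + 1)"] conjI)
        (auto intro!: mono inA)
    then show "\<exists>b\<in>A. 2 ^ s \<le> b - u \<and> b - u < 2 ^ (s + 1) \<and>
       (\<exists>y\<in>A. \<exists>z\<in>A. u \<le> y \<and> y < z \<and> z \<le> b \<and> int B * (z - y) \<le> b - u)"
      using \<sigma>[OF t(1)] t ab(3)[OF t(1)] by (intro bexI[of _ "b t"]) auto
  qed (use S'(3) in auto)
qed

section \<open>Exponents of unavoidability\<close>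

text \<open>\<open>L\<close> stands for the logarithm of the length of the interval. All
  \<open>l\<close> are quantified, with \<open>C\<close> depending on \<open>l\<close>, because a
  wave with ratio \<open>l\<close> is built from a shorter one with a larger ratio.\<close>

definition unavoidable :: "nat \<Rightarrow> (nat \<Rightarrow> nat) \<Rightarrow> nat \<Rightarrow> bool" where
  "unavoidable k \<pi> e \<longleftrightarrow>
     (\<forall>l\<ge>1. \<exists>C. \<forall>L\<ge>1. \<forall>A\<subseteq>{0..<2 ^ L}. C * L ^ e \<le> card A \<longrightarrow>
        (\<exists>x. lacunary_wave k \<pi> l x \<and> x ` {1..k + 1} \<subseteq> A))"

lemma unavoidable_1: "unavoidable 1 \<pi> 0"
  unfolding unavoidable_def
proof (intro allI impI exI[of _ 2])
  fix l :: int and L :: nat and A :: "int set"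
  assume "2 * L ^ 0 \<le> card A"
  then have A: "2 \<le> card A" by simp
  then have "finite A" by (auto intro: card_ge_0_finite)
  then obtain f where f: "bij_betw f {..<card A} A" "strict_mono_on {..<card A} f"
    using increasing_enumeration by blast
  have "f 0 < f 1" using f(2) A by (auto simp: strict_mono_on_def)
  moreover have "f 0 \<in> A" "f 1 \<in> A" using f(1) A by (auto simp: bij_betw_def)
  ultimately show "\<exists>x. lacunary_wave 1 \<pi> l x \<and> x ` {1..1 + 1} \<subseteq> A"
    by (intro exI[of _ "\<lambda>i. f (i - 1)"]) (auto simp: lacunary_wave_def atLeastAtMost_insertL[symmetric] numeral_2_eq_2)
qed

lemma lacunary_wave_pos: "lacunary_wave k \<pi> l x \<Longrightarrow> i \<in> {1..k} \<Longrightarrow> x i < x (i + 1)"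
  unfolding lacunary_wave_def by blast

lemma lacunary_wave_ratio:
  "lacunary_wave k \<pi> l x \<Longrightarrow> i \<in> {1..k} \<Longrightarrow> j \<in> {1..k} \<Longrightarrow> \<pi> j < \<pi> i \<Longrightarrow>
     l * (x (j + 1) - x j) \<le> x (i + 1) - x i"
  unfolding lacunary_wave_def by blast

text \<open>A wave for \<pi> without its minimum is found among the cluster starts. Its point at
  \<open>p\<close> is replaced by both ends of its cluster, whose diameter is the new smallest gap.
  Passing to clusters costs one factor \<open>L\<close>.\<close>

lemma unavoidable_insert:
  assumes un: "unavoidable k (\<pi> \<circ> skip p) e" and p: "p \<in> {1..k + 1}"
    and min: "\<And>i. i \<in> {1..k + 1} \<Longrightarrow> i \<noteq> p \<Longrightarrow> \<pi> p < \<pi> i"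
  shows "unavoidable (k + 1) \<pi> (e + 1)"
  unfolding unavoidable_def
proof (intro allI impI)
  fix l :: int assume l: "1 \<le> l"
  then have "1 \<le> 4 * l" by simp
  then obtain C where C: "\<And>L A. L \<ge> 1 \<Longrightarrow> A \<subseteq> {0..<2 ^ L} \<Longrightarrow> C * L ^ e \<le> card A \<Longrightarrow>
      \<exists>x. lacunary_wave k (\<pi> \<circ> skip p) (4 * l) x \<and> x ` {1..k + 1} \<subseteq> A"
    using un unfolding unavoidable_def by meson
  \<comment> \<open>The new gap is below \<open>2 ^ (s + 1)\<close> and \<open>2 * l\<close> times
    it must not exceed any old gap, so a separation of \<open>4 * l * 2 ^ s\<close> is
    enough.\<close>
  define K where "K = nat (4 * l)"
  have K: "int K = 4 * l" "1 \<le> K" using l by (auto simp: K_def)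
  show "\<exists>C. \<forall>L\<ge>1. \<forall>A\<subseteq>{0..<2 ^ L}. C * L ^ (e + 1) \<le> card A \<longrightarrow>
        (\<exists>x. lacunary_wave (k + 1) \<pi> l x \<and> x ` {1..k + 1 + 1} \<subseteq> A)"
  proof (intro exI[of _ "2 * K * C"] allI impI)
    fix L :: nat and A :: "int set"
    assume L: "1 \<le> L" and A: "A \<subseteq> {0..<2 ^ L}" and "2 * K * C * L ^ (e + 1) \<le> card A"
    \<comment> \<open>Blocks of two elements, that is \<open>B = 1\<close>: start and end suffice
      here.\<close>
    then have "(1 + 1) * (L * (K * (C * L ^ e))) \<le> card A" by (simp add: algebra_simps)
    from clusters[OF A _ K(2) L this]
    obtain s A' where A': "A' \<subseteq> A" "card A' = C * L ^ e"
      "\<forall>a\<in>A'. \<exists>b\<in>A. 2 ^ s \<le> b - a \<and> b - a < 2 ^ (s + 1)"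
      "\<forall>a\<in>A'. \<forall>a'\<in>A'. a < a' \<longrightarrow> a + 4 * l * 2 ^ s \<le> a'"
      unfolding K by (metis order_refl)
    obtain x where x: "lacunary_wave k (\<pi> \<circ> skip p) (4 * l) x" "x ` {1..k + 1} \<subseteq> A'"
      using C[OF L order_trans[OF A'(1) A]] A'(2) by auto
    have inA': "x i \<in> A'" if "i \<in> {1..k + 1}" for i using x(2) that by blast
    obtain b where b: "b \<in> A" "2 ^ s \<le> b - x p" "b - x p < 2 ^ (s + 1)"
      using A'(3) inA'[OF p] by blast
    have gap: "4 * l * 2 ^ s \<le> x (i + 1) - x i" if "i \<in> {1..k}" for i
      using A'(4) inA'[of i] inA'[of "i + 1"] lacunary_wave_pos[OF x(1) that] that by fastforce
    have pow: "(0 :: int) < 2 ^ s" by simp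
    have l_pow: "2 ^ s \<le> l * 2 ^ s"
      using mult_right_mono[OF l, of "2 ^ s"] by simp
    have "lacunary_wave (k + 1) \<pi> l (insert_pair x p (x p) b)"
    proof (rule lacunary_wave_insert[OF x(1) l p min])
      show "x p < b" "b \<le> x p + 2 ^ (s + 1)" using b(2,3) pow by linarith+
      show "2 * 2 ^ (s + 1) \<le> x (i + 1) - x i" if "i \<in> {1..k}" for i
        using gap[OF that] l_pow pow unfolding mult.assoc Suc_eq_plus1[symmetric] power_Suc by linarith
      show "2 * l * (b - x p) \<le> x (i + 1) - x i" if "i \<in> {1..k}" for i
        using order_trans[OF mult_left_mono[of "b - x p" "2 ^ (s + 1)" "2 * l"] _, of "x (i + 1) - x i"]
          gap[OF that] b(3) l by simp
    qed auto
    moreover have "insert_pair x p (x p) b ` {1..k + 2} \<subseteq> A"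
      using x(2) A'(1) b(1) inA'[OF p] p by (intro insert_pair_image) auto
    ultimately show "\<exists>x. lacunary_wave (k + 1) \<pi> l x \<and> x ` {1..k + 1 + 1} \<subseteq> A"
      by (intro exI[of _ "insert_pair x p (x p) b"]) (simp add: numeral_2_eq_2)
  qed
qed

text \<open>The smallest value of \<pi> sits at \<open>u\<close>, the second smallest at
  \<open>skip u v\<close>; the condition \<open>uv\<close> says that these positions are not
  adjacent. The two insertions then happen in different clusters of the same scale: one uses the
  full diameter, the other a much smaller gap inside its cluster. A single passage to clusters,
  hence one factor \<open>L\<close>, pays for both.\<close>

lemma unavoidable_insert_two:
  assumes un: "unavoidable k (\<pi> \<circ> skip u \<circ> skip v) e"
    and u: "u \<in> {1..k + 2}" and v: "v \<in> {1..k + 1}" and uv: "u \<noteq> v" "u \<noteq> v + 1"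
    and minu: "\<And>i. i \<in> {1..k + 2} \<Longrightarrow> i \<noteq> u \<Longrightarrow> \<pi> u < \<pi> i"
    and minv: "\<And>i. i \<in> {1..k + 1} \<Longrightarrow> i \<noteq> v \<Longrightarrow> (\<pi> \<circ> skip u) v < (\<pi> \<circ> skip u) i"
  shows "unavoidable (k + 2) \<pi> (e + 1)"
  unfolding unavoidable_def
proof (intro allI impI)
  fix l :: int assume l: "1 \<le> l"
  then have l4: "1 \<le> 4 * l" and "1 \<le> 4 * (4 * l)" by auto
  then obtain C where C: "\<And>L A. L \<ge> 1 \<Longrightarrow> A \<subseteq> {0..<2 ^ L} \<Longrightarrow> C * L ^ e \<le> card A \<Longrightarrow>
      \<exists>x. lacunary_wave k (\<pi> \<circ> skip u \<circ> skip v) (4 * (4 * l)) x \<and> x ` {1..k + 1} \<subseteq> A"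
    using un unfolding unavoidable_def by meson
  \<comment> \<open>\<open>K\<close> is the separation for an insertion with target ratio
    \<open>4 * l\<close> and new gap below \<open>2 ^ (s + 1)\<close>. The choice of
    \<open>B\<close> makes the inner gap satisfy \<open>2 * l * (z - y) \<le> 2 ^ s\<close>, a lower
    bound for the first inserted gap.\<close>
  define K where "K = nat (16 * l)"
  define B where "B = nat (4 * l)"
  have K: "int K = 16 * l" "1 \<le> K" and B: "int B = 4 * l" "1 \<le> B"
    using l by (auto simp: K_def B_def)
  show "\<exists>C. \<forall>L\<ge>1. \<forall>A\<subseteq>{0..<2 ^ L}. C * L ^ (e + 1) \<le> card A \<longrightarrow>
        (\<exists>x. lacunary_wave (k + 2) \<pi> l x \<and> x ` {1..k + 2 + 1} \<subseteq> A)"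
  proof (intro exI[of _ "(B + 1) * K * C"] allI impI)
    fix L :: nat and A :: "int set"
    assume L: "1 \<le> L" and A: "A \<subseteq> {0..<2 ^ L}" and "(B + 1) * K * C * L ^ (e + 1) \<le> card A"
    then have "(B + 1) * (L * (K * (C * L ^ e))) \<le> card A" by (simp add: algebra_simps)
    from clusters[OF A B(2) K(2) L this]
    obtain s A' where A': "A' \<subseteq> A" "card A' = C * L ^ e"
      and clust: "\<And>a. a \<in> A' \<Longrightarrow> \<exists>b\<in>A. 2 ^ s \<le> b - a \<and> b - a < 2 ^ (s + 1) \<and>
       (\<exists>y\<in>A. \<exists>z\<in>A. a \<le> y \<and> y < z \<and> z \<le> b \<and> 4 * l * (z - y) \<le> b - a)"
      and sep: "\<And>a a'. a \<in> A' \<Longrightarrow> a' \<in> A' \<Longrightarrow> a < a' \<Longrightarrow> a + 16 * l * 2 ^ s \<le> a'"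
      unfolding K B by metis
    obtain x where x: "lacunary_wave k (\<pi> \<circ> skip u \<circ> skip v) (4 * (4 * l)) x" "x ` {1..k + 1} \<subseteq> A'"
      using C[OF L order_trans[OF A'(1) A]] A'(2) by auto
    have inA': "x i \<in> A'" if "i \<in> {1..k + 1}" for i using x(2) that by blast
    obtain b where b: "b \<in> A" "2 ^ s \<le> b - x v" "b - x v < 2 ^ (s + 1)"
      using clust inA'[OF v] by blast
    have gap: "16 * l * 2 ^ s \<le> x (i + 1) - x i" if "i \<in> {1..k}" for i
      using sep[of "x i" "x (i + 1)"] inA'[of i] inA'[of "i + 1"] lacunary_wave_pos[OF x(1) that] that
      by auto
    have pow: "(0 :: int) < 2 ^ s" by simp
    have l_pow: "2 ^ s \<le> l * 2 ^ s"
      using mult_right_mono[OF l, of "2 ^ s"] by simp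
    define x' where "x' = insert_pair x v (x v) b"
    have x': "lacunary_wave (k + 1) (\<pi> \<circ> skip u) (4 * l) x'"
      unfolding x'_def
    proof (rule lacunary_wave_insert[OF x(1) l4 v minv])
      show "x v < b" "b \<le> x v + 2 ^ (s + 1)" using b(2,3) pow by linarith+
      show "2 * 2 ^ (s + 1) \<le> x (i + 1) - x i" if "i \<in> {1..k}" for i
        using gap[OF that] l_pow pow unfolding mult.assoc Suc_eq_plus1[symmetric] power_Suc by linarith
      show "2 * (4 * l) * (b - x v) \<le> x (i + 1) - x i" if "i \<in> {1..k}" for i
        using order_trans[OF mult_left_mono[of "b - x v" "2 ^ (s + 1)" "8 * l"] _, of "x (i + 1) - x i"]
          gap[OF that] b(3) l by simp
    qed auto
    have x'A: "x' ` {1..k + 2} \<subseteq> A"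
      unfolding x'_def using x(2) A'(1) b(1) inA'[OF v] v by (intro insert_pair_image) auto
    have gap_v: "2 ^ s \<le> x' (v + 1) - x' v"
      using b(2) by (simp add: x'_def insert_pair_def)
    \<comment> \<open>Every gap other than \<open>v\<close> is at least \<open>4 * l\<close> times
      the gap at \<open>v\<close>, the smallest one so far.\<close>
    have gap': "4 * l * 2 ^ s \<le> x' (i + 1) - x' i" if "i \<in> {1..k + 1}" "i \<noteq> v" for i
      using order_trans[OF mult_left_mono[OF gap_v, of "4 * l"]
          lacunary_wave_ratio[OF x' that(1) v minv[OF that]]] l by simp
    \<comment> \<open>Non-adjacency enters here: \<open>x' u\<close> is not the end \<open>b\<close>
      of the split cluster, so it is a cluster start with a cluster of its own.\<close>
    have "x' u \<in> A'"
    proof (cases "u < v")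
      case True
      then show ?thesis using u v inA'[of u] by (simp add: x'_def insert_pair_def)
    next
      case False
      then have "u - 1 \<in> {1..k + 1}" using u v uv by auto
      then show ?thesis using False uv inA'[of "u - 1"] by (simp add: x'_def insert_pair_def)
    qed
    from clust[OF this] obtain b' y z where yz: "y \<in> A" "z \<in> A" "x' u \<le> y" "y < z" "z \<le> b'"
      "4 * l * (z - y) \<le> b' - x' u" "b' - x' u < 2 ^ (s + 1)" by blast
    have "lacunary_wave (k + 1 + 1) \<pi> l (insert_pair x' u y z)"
    proof (rule lacunary_wave_insert[OF x' l])
      show "u \<in> {1..k + 1 + 1}" using u by simp
      show "\<pi> u < \<pi> i" if "i \<in> {1..k + 1 + 1}" "i \<noteq> u" for i using minu that by simp
      show "x' u \<le> y" "y < z" by fact+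
      show "z \<le> x' u + 2 ^ (s + 1)" using yz by linarith
      show "2 * 2 ^ (s + 1) \<le> x' (i + 1) - x' i" if "i \<in> {1..k + 1}" "i = u \<or> i + 1 = u" for i
      proof -
        \<comment> \<open>Again by non-adjacency, the short gap at \<open>v\<close> does not touch
          the point that is moved now.\<close>
        have "i \<noteq> v" using that(2) uv by auto
        from gap'[OF that(1) this] show ?thesis
          using l_pow unfolding mult.assoc Suc_eq_plus1[symmetric] power_Suc by linarith
      qed
      show "2 * l * (z - y) \<le> x' (i + 1) - x' i" if "i \<in> {1..k + 1}" for i
      proof -
        have "2 * l * (z - y) \<le> 2 ^ s" using yz(6,7) by simp
        also have "2 ^ s \<le> x' (i + 1) - x' i"
        proof (cases "i = v")
          case False
          from gap'[OF that this] show ?thesis using l_pow pow unfolding mult.assoc by linarith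
        qed (use gap_v in simp)
        finally show ?thesis .
      qed
    qed
    moreover have "insert_pair x' u y z ` {1..(k + 1) + 2} \<subseteq> A"
      using x'A u yz by (intro insert_pair_image) auto
    ultimately show "\<exists>x. lacunary_wave (k + 2) \<pi> l x \<and> x ` {1..k + 2 + 1} \<subseteq> A"
      by (intro exI[of _ "insert_pair x' u y z"]) (simp add: numeral_2_eq_2)
  qed
qed

lemma ex_strict_min:
  fixes \<pi> :: "'a \<Rightarrow> 'b::linorder"
  assumes "inj_on \<pi> S" "finite S" "S \<noteq> {}"
  obtains p where "p \<in> S" "\<And>i. i \<in> S \<Longrightarrow> i \<noteq> p \<Longrightarrow> \<pi> p < \<pi> i"
proof -
  have "Min (\<pi> ` S) \<in> \<pi> ` S" using assms by (intro Min_in) auto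
  then obtain p where p: "p \<in> S" "\<pi> p = Min (\<pi> ` S)" by auto
  have "\<pi> p < \<pi> i" if "i \<in> S" "i \<noteq> p" for i
  proof -
    have "\<pi> p \<le> \<pi> i" using p that assms by simp
    moreover have "\<pi> p \<noteq> \<pi> i" using inj_onD[OF assms(1) _ p(1) that(1)] that by auto
    ultimately show ?thesis by simp
  qed
  then show ?thesis using p that by blast
qed

text \<open>Deleting minima down to a single gap takes \<open>k\<close> steps, each costing one
  factor \<open>L\<close>.\<close>

lemma unavoidable_general:
  assumes "inj_on \<pi> {1..Suc k}"
  shows "unavoidable (Suc k) \<pi> k"
  using assms
proof (induction k arbitrary: \<pi>)
  case 0
  then show ?case using unavoidable_1 by simp
next
  case (Suc k)
  have inj: "inj_on \<pi> {1..Suc k + 1}" using Suc.prems by simp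
  obtain p where p: "p \<in> {1..Suc k + 1}" "\<And>i. i \<in> {1..Suc k + 1} \<Longrightarrow> i \<noteq> p \<Longrightarrow> \<pi> p < \<pi> i"
    by (rule ex_strict_min[OF inj]) auto
  have "unavoidable (Suc k) (\<pi> \<circ> skip p) k"
    by (rule Suc.IH) (rule inj_on_comp_skip[OF inj])
  from unavoidable_insert[OF this p] show ?case by simp
qed

text \<open>Deleting a minimum at distance at least two from a peak leaves the peak's neighbours
  alone. If the minimum is a neighbour of the peak, then the second smallest value, being adjacent
  to the minimum and not at the peak, lies just beyond it and becomes the new, lower
  neighbour.\<close>

lemma peak_skip:
  assumes peak: "is_peak (k + 1) \<pi> i"
    and u: "u \<in> {1..k + 1}" "\<And>i. i \<in> {1..k + 1} \<Longrightarrow> i \<noteq> u \<Longrightarrow> \<pi> u < \<pi> i"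
    and v: "v \<in> {1..k}" "\<And>i. i \<in> {1..k} \<Longrightarrow> i \<noteq> v \<Longrightarrow> (\<pi> \<circ> skip u) v < (\<pi> \<circ> skip u) i"
    and uv: "u = v \<or> u = v + 1"
  shows "\<exists>i. is_peak k (\<pi> \<circ> skip u) i"
proof -
  have i: "1 < i" "i < k + 1" "\<pi> (i - 1) < \<pi> i" "\<pi> (i + 1) < \<pi> i"
    using peak by (auto simp: is_peak_def)
  have "u \<noteq> i" using u(2)[of "i + 1"] i by auto
  then consider "u + 1 < i" | "u + 1 = i" | "u = i + 1" | "u > i + 1" by linarith
  then show ?thesis
  proof cases
    case 1
    then obtain j where "i = Suc (Suc j)" using u(1) by (metis add_2_eq_Suc add.commute atLeastAtMost_iff less_imp_Suc_add Suc_eq_plus1 add_Suc_right)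
    then have "is_peak k (\<pi> \<circ> skip u) (i - 1)" using 1 i u(1) by (auto simp: is_peak_def skip_def)
    then show ?thesis by blast
  next
    case 2
    \<comment> \<open>Equality would put the second smallest value at the peak itself, although
      \<open>\<pi> (i + 1)\<close> is smaller.\<close>
    have "u \<noteq> v"
    proof
      assume "u = v"
      then show False using v(2)[of "v + 1"] 2 i by (auto simp: skip_def)
    qed
    then have v2: "v + 2 = i" using uv 2 by simp
    then have "is_peak k (\<pi> \<circ> skip u) (i - 1)"
      using v(2)[of "i - 1"] v(1) 2 i by (auto simp: is_peak_def skip_def)
    then show ?thesis by blast
  next
    case 3
    \<comment> \<open>As before, this would put the second smallest value at the peak, above
      \<open>\<pi> (i - 1)\<close>.\<close>
    have "u \<noteq> v + 1"
    proof
      assume "u = v + 1"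
      then show False using v(2)[of "v - 1"] 3 i by (cases v) (auto simp: skip_def)
    qed
    then have "u = v" using uv by simp
    then have "is_peak k (\<pi> \<circ> skip u) i"
      using v(2)[of i] v(1) 3 i by (auto simp: is_peak_def skip_def)
    then show ?thesis by blast
  next
    case 4
    then have "is_peak k (\<pi> \<circ> skip u) i" using i u(1) by (auto simp: is_peak_def skip_def)
    then show ?thesis by blast
  qed
qed

text \<open>Minima are deleted singly, preserving a peak, as long as the two smallest values are
  adjacent. Once they are not, both are deleted for one factor \<open>L\<close> and the general
  bound treats the rest; this saves one factor in total.\<close>

lemma unavoidable_peak:
  assumes "inj_on \<pi> {1..k}" "is_peak k \<pi> i"
  shows "unavoidable k \<pi> (k - 2)"
  using assms
proof (induction k arbitrary: \<pi> i)
  case 0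
  then show ?case by (simp add: is_peak_def)
next
  case (Suc k)
  have k: "2 \<le> k" using Suc.prems(2) by (auto simp: is_peak_def)
  have inj: "inj_on \<pi> {1..k + 1}" using Suc.prems by simp
  obtain u where u: "u \<in> {1..k + 1}" "\<And>i. i \<in> {1..k + 1} \<Longrightarrow> i \<noteq> u \<Longrightarrow> \<pi> u < \<pi> i"
    by (rule ex_strict_min[OF inj]) auto
  have inj': "inj_on (\<pi> \<circ> skip u) {1..k}" using inj by (rule inj_on_comp_skip)
  obtain v where v: "v \<in> {1..k}" "\<And>i. i \<in> {1..k} \<Longrightarrow> i \<noteq> v \<Longrightarrow> (\<pi> \<circ> skip u) v < (\<pi> \<circ> skip u) i"
    by (rule ex_strict_min[OF inj']) (use k in auto)
  show ?case
  proof (cases "u = v \<or> u = v + 1")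
    case True
    then obtain j where "is_peak k (\<pi> \<circ> skip u) j"
      using peak_skip[OF _ u v] Suc.prems(2) by auto
    from unavoidable_insert[OF Suc.IH[OF inj' this] u]
    have "unavoidable (k + 1) \<pi> (k - 2 + 1)" .
    moreover have "k - 2 + 1 = Suc k - 2" using k by simp
    ultimately show ?thesis by simp
  next
    case False
    obtain h where h: "k = Suc (Suc h)" using k by (metis add_2_eq_Suc le_Suc_ex)
    have "unavoidable (Suc h) (\<pi> \<circ> skip u \<circ> skip v) h"
      by (rule unavoidable_general, rule inj_on_comp_skip) (use inj' h in simp)
    from unavoidable_insert_two[OF this] have "unavoidable (Suc h + 2) \<pi> (h + 1)"
      using u v False unfolding h by simp
    then show ?thesis unfolding h by simp
  qed
qed

lemma unavoidable_card_bound: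
  assumes "unavoidable k \<pi> e" "inj_on \<pi> {1..k}"
  shows "\<exists>C. \<forall>L\<ge>1. \<forall>A\<subseteq>{0..<2 ^ L}. \<not> contains_wave k \<pi> A \<longrightarrow> card A < C * L ^ e"
proof -
  obtain C where C: "\<And>L A. L \<ge> 1 \<Longrightarrow> A \<subseteq> {0..<2 ^ L} \<Longrightarrow> C * L ^ e \<le> card A \<Longrightarrow>
      \<exists>x. lacunary_wave k \<pi> 2 x \<and> x ` {1..k + 1} \<subseteq> A"
    using assms(1) unfolding unavoidable_def by (metis one_le_numeral)
  show ?thesis
  proof (intro exI[of _ C] allI impI)
    fix L A assume "1 \<le> L" "A \<subseteq> {0..<2 ^ L}" "\<not> contains_wave k \<pi> A"
    then show "card A < C * L ^ e"
      using C[of L A] lacunary_wave_is_wave[OF _ assms(2)] unfolding contains_wave_def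
      by (meson not_le)
  qed
qed

section \<open>Wave-free sets for permutations without peaks\<close>

lemma is_wave_gap_less:
  "is_wave k \<pi> x \<Longrightarrow> i \<in> {1..k} \<Longrightarrow> j \<in> {1..k} \<Longrightarrow> \<pi> j < \<pi> i \<Longrightarrow> x (j + 1) - x j < x (i + 1) - x i"
  unfolding is_wave_def by blast

lemma is_wave_mono:
  assumes "is_wave k \<pi> x" "1 \<le> i" "i \<le> j" "j \<le> k + 1"
  shows "x i \<le> x j"
  using assms(3,4)
proof (induction j rule: dec_induct)
  case (step n)
  have "x n < x (n + 1)" using assms(1,2) step unfolding is_wave_def by simp
  then show ?case using step by simp
qed simp

lemma is_wave_take: "is_wave (Suc k) \<pi> x \<Longrightarrow> is_wave k \<pi> x"
proof -
  have "{1..k} \<subseteq> {1..Suc k}" by auto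
  then show "is_wave (Suc k) \<pi> x \<Longrightarrow> is_wave k \<pi> x" unfolding is_wave_def by blast
qed

lemma is_wave_drop:
  assumes "is_wave (Suc k) \<pi> x"
  shows "is_wave k (\<pi> \<circ> Suc) (x \<circ> Suc)"
proof -
  have *: "Suc i \<in> {1..Suc k}" if "i \<in> {1..k}" for i using that by simp
  show ?thesis
    using assms * unfolding is_wave_def comp_def by (metis Suc_eq_plus1)
qed

text \<open>A gap that joins two blocks is at least as long as every gap to its right, so it cannot
  precede the last and largest gap of a wave. Only that last gap may leave a block; the points
  before it form a shorter wave inside one block.\<close>

lemma wave_free_blocks_max_last:
  fixes blk :: "int \<Rightarrow> nat"
  assumes blocks: "\<And>c. \<not> contains_wave k \<pi> {a \<in> A. blk a = c}"
    and far: "\<And>a b c d. {a, b, c, d} \<subseteq> A \<Longrightarrow> a < b \<Longrightarrow> b \<le> c \<Longrightarrow> c < d \<Longrightarrow> blk a \<noteq> blk b \<Longrightarrow> d - c \<le> b - a"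
    and max: "\<And>i. i \<in> {1..k} \<Longrightarrow> \<pi> i < \<pi> (Suc k)"
  shows "\<not> contains_wave (Suc k) \<pi> A"
proof
  assume "contains_wave (Suc k) \<pi> A"
  then obtain x where x: "is_wave (Suc k) \<pi> x" "x ` {1..Suc k + 1} \<subseteq> A"
    unfolding contains_wave_def by blast
  have inA: "x i \<in> A" if "i \<in> {1..Suc k + 1}" for i using x(2) that by blast
  have pos: "x i < x (i + 1)" if "i \<in> {1..Suc k}" for i
    using x(1) that unfolding is_wave_def by blast
  have same: "blk (x (i + 1)) = blk (x i)" if "i \<in> {1..k}" for i
  proof (rule ccontr)
    assume *: "blk (x (i + 1)) \<noteq> blk (x i)"
    have "x (Suc k + 1) - x (Suc k) \<le> x (i + 1) - x i"
    proof (rule far)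
      show "{x i, x (i + 1), x (Suc k), x (Suc k + 1)} \<subseteq> A" using inA that by simp
      show "x (i + 1) \<le> x (Suc k)" using is_wave_mono[OF x(1)] that by simp
    qed (use * pos[of i] pos[of "Suc k"] that in auto)
    then show False
      using is_wave_gap_less[OF x(1) _ _ max[OF that]] that by fastforce
  qed
  have const: "blk (x i) = blk (x 1)" if "1 \<le> i" "i \<le> k + 1" for i
    using that
  proof (induction i rule: dec_induct)
    case (step n)
    then show ?case using same[of n] by simp
  qed simp
  have "x ` {1..k + 1} \<subseteq> {a \<in> A. blk a = blk (x 1)}"
    by (intro image_subsetI CollectI conjI inA const) auto
  moreover have "is_wave k \<pi> x" using x(1) by (rule is_wave_take)
  ultimately have "contains_wave k \<pi> {a \<in> A. blk a = blk (x 1)}"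
    unfolding contains_wave_def by (intro exI[of _ "x"] conjI)
  then show False using blocks by simp
qed

text \<open>Mirror image: only the first gap may join two blocks, so the points from
  \<open>x 2\<close> on share a block.\<close>

lemma wave_free_blocks_max_first:
  fixes blk :: "int \<Rightarrow> nat"
  assumes blocks: "\<And>c. \<not> contains_wave k (\<pi> \<circ> Suc) {a \<in> A. blk a = c}"
    and far: "\<And>a b c d. {a, b, c, d} \<subseteq> A \<Longrightarrow> a < b \<Longrightarrow> b \<le> c \<Longrightarrow> c < d \<Longrightarrow> blk c \<noteq> blk d \<Longrightarrow> b - a \<le> d - c"
    and max: "\<And>i. i \<in> {2..Suc k} \<Longrightarrow> \<pi> i < \<pi> 1"
  shows "\<not> contains_wave (Suc k) \<pi> A"
proof
  assume "contains_wave (Suc k) \<pi> A"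
  then obtain x where x: "is_wave (Suc k) \<pi> x" "x ` {1..Suc k + 1} \<subseteq> A"
    unfolding contains_wave_def by blast
  have inA: "x i \<in> A" if "i \<in> {1..Suc k + 1}" for i using x(2) that by blast
  have pos: "x i < x (i + 1)" if "i \<in> {1..Suc k}" for i
    using x(1) that unfolding is_wave_def by blast
  have same: "blk (x (i + 1)) = blk (x i)" if "i \<in> {2..Suc k}" for i
  proof (rule ccontr)
    assume *: "blk (x (i + 1)) \<noteq> blk (x i)"
    have "x (1 + 1) - x 1 \<le> x (i + 1) - x i"
    proof (rule far)
      show "{x 1, x (1 + 1), x i, x (i + 1)} \<subseteq> A"
        using inA[of 1] inA[of "1 + 1"] inA[of i] inA[of "i + 1"] that by simp
      show "x (1 + 1) \<le> x i" using is_wave_mono[OF x(1)] that by simp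
    qed (use * pos[of i] pos[of 1] that in auto)
    then show False
      using is_wave_gap_less[OF x(1) _ _ max[OF that]] that by fastforce
  qed
  have const: "blk (x i) = blk (x 2)" if "2 \<le> i" "i \<le> k + 2" for i
    using that
  proof (induction i rule: dec_induct)
    case (step n)
    then show ?case using same[of n] by simp
  qed simp
  have "(x \<circ> Suc) ` {1..k + 1} \<subseteq> {a \<in> A. blk a = blk (x 2)}"
    unfolding comp_def by (intro image_subsetI CollectI conjI inA const) auto
  moreover have "is_wave k (\<pi> \<circ> Suc) (x \<circ> Suc)" using x(1) by (rule is_wave_drop)
  ultimately have "contains_wave k (\<pi> \<circ> Suc) {a \<in> A. blk a = blk (x 2)}"
    unfolding contains_wave_def by (intro exI[of _ "x \<circ> Suc"] conjI)
  then show False using blocks by simp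
qed

lemma contains_wave_translate:
  assumes "contains_wave k \<pi> ((\<lambda>a. a + t) ` A)"
  shows "contains_wave k \<pi> A"
proof -
  obtain x where x: "is_wave k \<pi> x" "x ` {1..k + 1} \<subseteq> (\<lambda>a. a + t) ` A"
    using assms unfolding contains_wave_def by blast
  have "is_wave k \<pi> (\<lambda>i. x i - t)" using x(1) unfolding is_wave_def by simp
  moreover have "(\<lambda>i. x i - t) ` {1..k + 1} \<subseteq> A" using x(2) by fastforce
  ultimately show ?thesis unfolding contains_wave_def by blast
qed

lemma contains_wave_subset: "contains_wave k \<pi> A \<Longrightarrow> A \<subseteq> B \<Longrightarrow> contains_wave k \<pi> B"
  unfolding contains_wave_def by blast

text \<open>Label each point by a translate that contains it; each label class then lies in a
  translate of one wave-free set.\<close>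

lemma union_translates:
  fixes A :: "nat \<Rightarrow> int set" and pos :: "nat \<Rightarrow> int"
  assumes A: "\<And>j. j < m \<Longrightarrow> A j \<subseteq> {0..<W}"
    and disj: "\<And>i j. i < m \<Longrightarrow> j < m \<Longrightarrow> i \<noteq> j \<Longrightarrow> pos i + W \<le> pos j \<or> pos j + W \<le> pos i"
    and free: "\<And>j. j < m \<Longrightarrow> \<not> contains_wave k \<pi> (A j)"
  defines "U \<equiv> \<Union>j<m. (\<lambda>a. a + pos j) ` A j"
  shows "\<exists>blk. (\<forall>a\<in>U. blk a < m \<and> pos (blk a) \<le> a \<and> a < pos (blk a) + W) \<and>
           (\<forall>c. \<not> contains_wave k \<pi> {a \<in> U. blk a = c})"
proof -
  have "\<exists>j. j < m \<and> a \<in> (\<lambda>a. a + pos j) ` A j" if "a \<in> U" for a using that by (auto simp: U_def)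
  then obtain blk where blk: "\<And>a. a \<in> U \<Longrightarrow> blk a < m \<and> a \<in> (\<lambda>b. b + pos (blk a)) ` A (blk a)"
    by metis
  have bd: "blk a < m \<and> pos (blk a) \<le> a \<and> a < pos (blk a) + W" if "a \<in> U" for a
    using blk[OF that] A[of "blk a"] by fastforce
  have "\<not> contains_wave k \<pi> {a \<in> U. blk a = c}" for c
  proof (cases "c < m")
    case True
    have "{a \<in> U. blk a = c} \<subseteq> (\<lambda>b. b + pos c) ` A c" using blk by auto
    then show ?thesis
      using contains_wave_subset contains_wave_translate free[OF True] by blast
  next
    case False
    then have "{a \<in> U. blk a = c} = {}" using blk by auto
    moreover have "\<not> contains_wave k \<pi> {}" by (simp add: contains_wave_def)
    ultimately show ?thesis by (simp only:) simp
  qed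
  then show ?thesis using bd by (intro exI[of _ blk] conjI ballI allI) simp_all
qed

lemma ex_strict_max:
  fixes \<pi> :: "'a \<Rightarrow> 'b::linorder"
  assumes "inj_on \<pi> S" "finite S" "S \<noteq> {}"
  obtains p where "p \<in> S" "\<And>i. i \<in> S \<Longrightarrow> i \<noteq> p \<Longrightarrow> \<pi> i < \<pi> p"
proof -
  have "Max (\<pi> ` S) \<in> \<pi> ` S" using assms by (intro Max_in) auto
  then obtain p where p: "p \<in> S" "\<pi> p = Max (\<pi> ` S)" by auto
  have "\<pi> i < \<pi> p" if "i \<in> S" "i \<noteq> p" for i
  proof -
    have "\<pi> i \<le> \<pi> p" using p that assms by simp
    moreover have "\<pi> i \<noteq> \<pi> p" using inj_onD[OF assms(1) _ that(1) p(1)] that by auto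
    ultimately show ?thesis by simp
  qed
  then show ?thesis using p that by blast
qed

lemma four_pow_gap: "i < j \<Longrightarrow> 4 * (4 :: int) ^ i \<le> 4 ^ j"
  using power_increasing[of "Suc i" j "4 :: int"] by simp

text \<open>Prescribing \<open>m ^ k\<close> residues strengthens a cardinality bound in a way that
  passes through the induction: translations by multiples of \<open>q\<close> preserve residues, so
  the \<open>m\<close> blocks can share the list \<rho> among them.\<close>

lemma wave_free_residues:
  fixes q :: int and \<rho> :: "nat \<Rightarrow> int"
  assumes "inj_on \<pi> {1..Suc k}" "\<nexists>i. is_peak (Suc k) \<pi> i" "0 < q" "1 \<le> m"
  shows "\<exists>A\<subseteq>{0..<q * 4 ^ (k * m)}. \<not> contains_wave (Suc k) \<pi> A \<and>
           (\<forall>i<m ^ k. \<exists>a\<in>A. a mod q = \<rho> i mod q)"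
  using assms(1,2)
proof (induction k arbitrary: \<pi> \<rho>)
  case 0
  have "\<not> contains_wave (Suc 0) \<pi> {\<rho> 0 mod q}"
  proof
    assume "contains_wave (Suc 0) \<pi> {\<rho> 0 mod q}"
    then obtain x where x: "is_wave (Suc 0) \<pi> x" "x ` {1..Suc 0 + 1} \<subseteq> {\<rho> 0 mod q}"
      unfolding contains_wave_def by blast
    have "1 \<in> {1..Suc 0 + 1}" "2 \<in> {1..Suc 0 + 1}" by auto
    then have "x 1 = x 2" using x(2) by (metis image_subset_iff singletonD)
    moreover have "x 1 < x (1 + 1)" using x(1) by (simp add: is_wave_def)
    ultimately show False by (simp add: numeral_2_eq_2)
  qed
  moreover have "{\<rho> 0 mod q} \<subseteq> {0..<q}" using \<open>0 < q\<close> by simp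
  ultimately show ?case by (intro exI[of _ "{\<rho> 0 mod q}"] conjI) simp_all
next
  case (Suc k)
  define W where "W = q * 4 ^ (k * m)"
  have W: "0 < W" using \<open>0 < q\<close> by (simp add: W_def)
  obtain p where p: "p \<in> {1..Suc (Suc k)}" "\<And>i. i \<in> {1..Suc (Suc k)} \<Longrightarrow> i \<noteq> p \<Longrightarrow> \<pi> i < \<pi> p"
    by (rule ex_strict_max[OF Suc.prems(1)]) auto
  \<comment> \<open>A maximum at an interior position would be a peak.\<close>
  have "p = 1 \<or> p = Suc (Suc k)"
  proof (rule ccontr)
    assume *: "\<not> ?thesis"
    then have "is_peak (Suc (Suc k)) \<pi> p"
      using p(1) p(2)[of "p - 1"] p(2)[of "p + 1"] unfolding is_peak_def by fastforce
    then show False using Suc.prems(2) by blast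
  qed
  define \<pi>' where "\<pi>' = (if p = 1 then \<pi> \<circ> Suc else \<pi>)"
  have inj': "inj_on \<pi>' {1..Suc k}"
  proof -
    have "inj_on (\<pi> \<circ> Suc) {1..Suc k}"
      by (rule comp_inj_on[OF inj_on_subset[OF inj_Suc] inj_on_subset[OF Suc.prems(1)]]) auto
    moreover have "inj_on \<pi> {1..Suc k}" by (rule inj_on_subset[OF Suc.prems(1)]) auto
    ultimately show ?thesis by (simp add: \<pi>'_def)
  qed
  have no_peak': "\<nexists>i. is_peak (Suc k) \<pi>' i"
  proof
    assume "\<exists>i. is_peak (Suc k) \<pi>' i"
    then obtain i where "is_peak (Suc k) \<pi>' i" by blast
    then have "is_peak (Suc (Suc k)) \<pi> (if p = 1 then Suc i else i)"
      unfolding \<pi>'_def is_peak_def by auto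
    then show False using Suc.prems(2) by blast
  qed
  have "\<exists>A\<subseteq>{0..<W}. \<not> contains_wave (Suc k) \<pi>' A \<and>
      (\<forall>i<m ^ k. \<exists>a\<in>A. a mod q = \<rho> (j * m ^ k + i) mod q)" for j
    unfolding W_def by (rule Suc.IH[OF inj' no_peak', of "\<lambda>i. \<rho> (j * m ^ k + i)"])
  then obtain A where A: "\<And>j. A j \<subseteq> {0..<W}" "\<And>j. \<not> contains_wave (Suc k) \<pi>' (A j)"
    "\<And>i j. i < m ^ k \<Longrightarrow> \<exists>a\<in>A j. a mod q = \<rho> (j * m ^ k + i) mod q" by metis
  \<comment> \<open>Block positions in units of \<open>W\<close>. If the first gap is the largest,
    distances grow to the right; otherwise they shrink to the right, with the blocks listed from
    right to left.\<close>
  define h :: "nat \<Rightarrow> int" where "h j = (if p = 1 then 4 ^ j else 4 ^ m - 4 ^ Suc j)" for j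
  define pos where "pos j = W * h j" for j
  have W_mono: "W * a \<le> W * b" if "a \<le> b" for a b :: int using that W by simp
  have h_range: "0 \<le> h j" "h j + 1 \<le> 4 ^ m" if "j < m" for j
    using power_increasing[of "Suc j" m "4 :: int"] that one_le_power[of "4 :: int" j]
    by (auto simp: h_def simp del: one_le_power)
  have h_gap: "(if p = 1 then h i + 1 else h j + 1) \<le> (if p = 1 then h j else h i)" if "i < j" for i j
    using four_pow_gap[OF that] one_le_power[of "4 :: int" i] by (auto simp: h_def simp del: one_le_power)
  define U where "U = (\<Union>j<m. (\<lambda>a. a + pos j) ` A j)"
  have disj: "pos i + W \<le> pos j \<or> pos j + W \<le> pos i" if "i \<noteq> j" for i j
    using h_gap[of i j] h_gap[of j i] W_mono[of "h i + 1" "h j"] W_mono[of "h j + 1" "h i"] that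
    by (cases i j rule: linorder_cases) (auto simp: pos_def algebra_simps split: if_splits)
  have "\<exists>blk. (\<forall>a\<in>U. blk a < m \<and> pos (blk a) \<le> a \<and> a < pos (blk a) + W) \<and>
      (\<forall>c. \<not> contains_wave (Suc k) \<pi>' {a \<in> U. blk a = c})"
    unfolding U_def by (rule union_translates) (rule A(1), erule disj, rule A(2))
  then obtain blk where blk:
    "\<And>a. a \<in> U \<Longrightarrow> blk a < m \<and> pos (blk a) \<le> a \<and> a < pos (blk a) + W"
    "\<And>c. \<not> contains_wave (Suc k) \<pi>' {a \<in> U. blk a = c}" by blast
  have "\<not> contains_wave (Suc (Suc k)) \<pi> U"
  proof (cases "p = 1")
    case True
    show ?thesis
    proof (rule wave_free_blocks_max_first)
      show "\<not> contains_wave (Suc k) (\<pi> \<circ> Suc) {a \<in> U. blk a = c}" for c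
        using blk(2) True by (simp add: \<pi>'_def)
      show "\<pi> i < \<pi> 1" if "i \<in> {2..Suc (Suc k)}" for i using p(2)[of i] True that by simp
      fix a b c d assume *: "{a, b, c, d} \<subseteq> U" "a < b" "b \<le> c" "c < d" "blk c \<noteq> blk d"
      have bd: "pos (blk c) \<le> c" "c < pos (blk c) + W" "pos (blk d) \<le> d" "d < pos (blk d) + W"
        using blk(1)[of c] blk(1)[of d] *(1) by auto
      have "0 \<le> a" using blk(1)[of a] *(1) h_range(1)[of "blk a"] W by (auto simp: pos_def intro: order_trans[rotated])
      have "blk c < blk d"
      proof (rule ccontr)
        assume "\<not> blk c < blk d"
        then have "blk d < blk c" using * by simp
        from W_mono[of "h (blk d) + 1" "h (blk c)"] h_gap[OF this] show False
          using bd *(4) True by (simp add: pos_def algebra_simps)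
      qed
      \<comment> \<open>Since \<open>0 \<le> a\<close> and \<open>b \<le> c\<close>, the gap
        \<open>b - a\<close> is at most \<open>c\<close>, so it suffices that \<open>d\<close> is at
        least \<open>2 * c\<close>. Base 4 leaves room for the block length
        \<open>W\<close>.\<close>
      have "W * (2 * 4 ^ blk c + 2) \<le> W * 4 ^ blk d"
        by (rule W_mono) (use four_pow_gap[OF \<open>blk c < blk d\<close>] one_le_power[of "4 :: int" "blk c"] in linarith)
      then show "b - a \<le> d - c"
        using bd *(3) \<open>0 \<le> a\<close> True by (simp add: pos_def h_def algebra_simps)
    qed
  next
    case False
    then have p': "p = Suc (Suc k)" using \<open>p = 1 \<or> p = Suc (Suc k)\<close> by blast
    show ?thesis
    proof (rule wave_free_blocks_max_last)
      show "\<not> contains_wave (Suc k) \<pi> {a \<in> U. blk a = c}" for c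
        using blk(2) False by (simp add: \<pi>'_def)
      show "\<pi> i < \<pi> (Suc (Suc k))" if "i \<in> {1..Suc k}" for i using p(2)[of i] p' that by simp
      fix a b c d assume *: "{a, b, c, d} \<subseteq> U" "a < b" "b \<le> c" "c < d" "blk a \<noteq> blk b"
      have bd: "pos (blk a) \<le> a" "a < pos (blk a) + W" "pos (blk b) \<le> b" "b < pos (blk b) + W"
        using blk(1)[of a] blk(1)[of b] *(1) by auto
      have "d < pos (blk d) + W" "blk d < m" using blk(1)[of d] *(1) by auto
      then have "d < W * 4 ^ m"
        using W_mono[OF h_range(2), of "blk d"] by (simp add: pos_def algebra_simps)
      have "blk b < blk a"
      proof (rule ccontr)
        assume "\<not> blk b < blk a"
        then have "blk a < blk b" using * by simp
        from W_mono[of "h (blk b) + 1" "h (blk a)"] h_gap[OF this] show False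
          using bd *(2) False by (simp add: pos_def algebra_simps)
      qed
      \<comment> \<open>Dually, \<open>d - c\<close> is bounded by the distance from
        \<open>b\<close> to the right end \<open>W * 4 ^ m\<close>, which is at most
        \<open>W * (4 * 4 ^ blk b)\<close>.\<close>
      have "W * (8 * 4 ^ blk b + 1) \<le> W * (4 * 4 ^ blk a)"
        by (rule W_mono) (use four_pow_gap[OF \<open>blk b < blk a\<close>] one_le_power[of "4 :: int" "blk b"] in linarith)
      then show "d - c \<le> b - a"
        using bd *(3) \<open>d < W * 4 ^ m\<close> False by (simp add: pos_def h_def algebra_simps)
    qed
  qed
  moreover have "U \<subseteq> {0..<q * 4 ^ (Suc k * m)}"
  proof
    fix a assume "a \<in> U"
    then have "blk a < m" "pos (blk a) \<le> a" "a < pos (blk a) + W" using blk(1) by auto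
    moreover have "q * 4 ^ (Suc k * m) = W * 4 ^ m" by (simp add: W_def power_add mult_ac)
    ultimately show "a \<in> {0..<q * 4 ^ (Suc k * m)}"
      using W_mono[OF h_range(2), of "blk a"] W_mono[OF h_range(1), of "blk a"]
      by (simp add: pos_def algebra_simps)
  qed
  moreover have "\<exists>a\<in>U. a mod q = \<rho> i mod q" if "i < m ^ Suc k" for i
  proof -
    have "0 < m ^ k" using \<open>1 \<le> m\<close> by simp
    \<comment> \<open>The quotient of \<open>i\<close> by \<open>m ^ k\<close> selects the block,
      the remainder the entry within it.\<close>
    then have "i div m ^ k < m" "i mod m ^ k < m ^ k" using that by (auto simp: less_mult_imp_div_less)
    then obtain a where a: "a \<in> A (i div m ^ k)" "a mod q = \<rho> i mod q"
      using A(3)[of "i mod m ^ k" "i div m ^ k"] unfolding div_mult_mod_eq by blast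
    have "(a + pos (i div m ^ k)) mod q = a mod q" by (simp add: pos_def W_def mult_ac)
    then show ?thesis using a \<open>i div m ^ k < m\<close> unfolding U_def
      by (intro bexI[of _ "a + pos (i div m ^ k)"]) auto
  qed
  ultimately show ?case by blast
qed

section \<open>Growth rates\<close>

lemma card_le_wave_g:
  assumes "A \<subseteq> {1..int n}" "\<not> contains_wave k \<pi> A"
  shows "card A \<le> wave_g k \<pi> n"
  unfolding wave_g_def
proof (rule Max_ge)
  show "finite {card A |A. A \<subseteq> {1..int n} \<and> \<not> contains_wave k \<pi> A}"
    by (rule finite_subset[of _ "card ` Pow {1..int n}"]) auto
qed (use assms in blast)

lemma forces_wave_mono:
  assumes "forces_wave k \<pi> r M" "M \<le> M'"
  shows "forces_wave k \<pi> r M'"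
  unfolding forces_wave_def
proof (intro allI impI)
  fix c :: "int \<Rightarrow> nat" assume c: "c ` {1..int M'} \<subseteq> {..<r}"
  have sub: "{1..int M} \<subseteq> {1..int M'}" using assms(2) by auto
  then have "c ` {1..int M} \<subseteq> {..<r}" using c by (meson image_mono order_trans)
  then obtain a where "a < r" "contains_wave k \<pi> {m \<in> {1..int M}. c m = a}"
    using assms(1) unfolding forces_wave_def by blast
  moreover have "{m \<in> {1..int M}. c m = a} \<subseteq> {m \<in> {1..int M'}. c m = a}" using sub by blast
  ultimately show "\<exists>a<r. contains_wave k \<pi> {m \<in> {1..int M'}. c m = a}"
    using contains_wave_subset by blast
qed

text \<open>Too few elements fit into \<open>r\<close> wave-free colour classes to cover the
  interval.\<close>

lemma forces_wave_density:
  assumes "r * wave_g k \<pi> M < M"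
  shows "forces_wave k \<pi> r M"
  unfolding forces_wave_def
proof (intro allI impI, rule ccontr)
  fix c :: "int \<Rightarrow> nat"
  let ?X = "\<lambda>a. {m \<in> {1..int M}. c m = a}"
  assume c: "c ` {1..int M} \<subseteq> {..<r}" and *: "\<not> (\<exists>a<r. contains_wave k \<pi> (?X a))"
  have "(\<Union>a<r. ?X a) = {1..int M}" using c by fast
  then have "M = card (\<Union>a<r. ?X a)" by simp
  also have "\<dots> \<le> (\<Sum>a<r. card (?X a))" by (rule card_UN_le) simp
  also have "\<dots> \<le> (\<Sum>a<r. wave_g k \<pi> M)"
    by (intro sum_mono card_le_wave_g) (use * in auto)
  finally show False using assms by simp
qed

section \<open>Upper bounds in terms of logarithms\<close>

text \<open>One factor 2 absorbs the rounding of \<open>log 2 x \<ge> 1\<close>, the other comes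
  from \<open>ln 2 \<ge> 1 / 2\<close>.\<close>

lemma ex_dyadic_length:
  fixes x :: real
  assumes "2 \<le> x"
  shows "\<exists>L\<ge>1. x < 2 ^ L \<and> real L \<le> 4 * ln x"
proof -
  have l: "1 \<le> log 2 x" using assms by simp
  define L where "L = nat \<lfloor>log 2 x\<rfloor> + 1"
  have L: "real L = of_int \<lfloor>log 2 x\<rfloor> + 1" using l by (simp add: L_def)
  have "log 2 x \<le> 2 * ln x"
  proof -
    have "exp 1 \<le> (4 :: real)" using exp_le by simp
    then have "1 \<le> ln (4 :: real)" by (simp add: ln_ge_iff)
    also have "ln (4 :: real) = 2 * ln 2" using ln_realpow[of "2 :: real" 2] by simp
    finally have "log 2 x * (1 / 2) \<le> log 2 x * ln 2"
      using l by (intro mult_left_mono) auto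
    then show ?thesis by (simp add: log_def)
  qed
  then have "real L \<le> 4 * ln x" using L l by linarith
  moreover have "x < 2 ^ L"
  proof -
    have "log 2 x < real L" using L by linarith
    then have "x < 2 powr real L" using assms by (simp add: log_less_iff)
    then show ?thesis by (simp add: powr_realpow)
  qed
  ultimately show ?thesis by (intro exI[of _ L]) (simp add: L_def)
qed

lemma wave_g_dyadic:
  assumes "unavoidable k \<pi> e" "inj_on \<pi> {1..k}"
  shows "\<exists>C\<ge>1. \<forall>L\<ge>1. \<forall>n<2 ^ L. wave_g k \<pi> n < C * L ^ e"
proof -
  obtain C where C: "\<And>L A. 1 \<le> L \<Longrightarrow> A \<subseteq> {0..<2 ^ L} \<Longrightarrow> \<not> contains_wave k \<pi> A \<Longrightarrow> card A < C * L ^ e"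
    using unavoidable_card_bound[OF assms] by blast
  have *: "wave_g k \<pi> n < C * L ^ e" if "1 \<le> L" "n < 2 ^ L" for L n
  proof -
    obtain A where A: "A \<subseteq> {1..int n}" "\<not> contains_wave k \<pi> A" "card A = wave_g k \<pi> n"
      using wave_g_attained by blast
    have "int n < 2 ^ L" using that(2) by (metis of_nat_less_iff of_nat_numeral of_nat_power)
    then have "{1..int n} \<subseteq> {0..<2 ^ L}"
      by (intro subsetI) (unfold atLeastAtMost_iff atLeastLessThan_iff, linarith)
    then have "A \<subseteq> {0..<2 ^ L}" using A(1) by (rule order_trans[rotated])
    then show ?thesis using C[OF that(1) _ A(2)] A(3) by simp
  qed
  moreover have "1 \<le> C" using *[of 1 0] by (cases C) auto
  ultimately show ?thesis by blast
qed

lemma wave_g_bigo: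
  assumes "unavoidable k \<pi> e" "inj_on \<pi> {1..k}"
  shows "(\<lambda>n. real (wave_g k \<pi> n)) \<in> O[at_top](\<lambda>n. ln (real n) ^ e)"
proof -
  obtain C where C: "\<And>L n. 1 \<le> L \<Longrightarrow> n < 2 ^ L \<Longrightarrow> wave_g k \<pi> n < C * L ^ e"
    using wave_g_dyadic[OF assms] by blast
  have "norm (real (wave_g k \<pi> n)) \<le> (real C * 4 ^ e) * norm (ln (real n) ^ e)" if "2 \<le> n" for n
  proof -
    have "2 \<le> real n" using that by simp
    from ex_dyadic_length[OF this]
    obtain L where L: "1 \<le> L" "real n < 2 ^ L" "real L \<le> 4 * ln (real n)" by blast
    have "n < 2 ^ L" using L(2) by (metis of_nat_less_iff of_nat_numeral of_nat_power)
    then have "wave_g k \<pi> n \<le> C * L ^ e" using C[OF L(1)] by (simp add: less_imp_le)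
    then have "real (wave_g k \<pi> n) \<le> real (C * L ^ e)" by (rule of_nat_mono)
    also have "\<dots> = real C * real L ^ e" by simp
    also have "\<dots> \<le> real C * (4 * ln (real n)) ^ e"
      using L(3) by (intro mult_left_mono power_mono) auto
    finally show ?thesis using that by (simp add: power_mult_distrib mult_ac)
  qed
  then show ?thesis
    by (intro bigoI[of _ "real C * 4 ^ e"] eventually_at_top_linorderI[of 2]) blast
qed

lemma eventually_ln_power_le:
  "\<forall>\<^sub>F r :: nat in at_top. K * ln (real r) ^ e \<le> real r"
proof -
  have "filterlim (\<lambda>r :: nat. ln (real r)) at_top at_top"
    by (rule filterlim_compose[OF ln_at_top filterlim_real_sequentially])
  from filterlim_compose[OF tendsto_power_div_exp_0[of e] this]
  have "(\<lambda>r :: nat. K * (ln (real r) ^ e / exp (ln (real r)))) \<longlonglongrightarrow> K * 0"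
    by (intro tendsto_mult tendsto_const)
  then have "\<forall>\<^sub>F r :: nat in at_top. K * (ln (real r) ^ e / exp (ln (real r))) < 1"
    by (rule order_tendstoD) simp
  then show ?thesis using eventually_gt_at_top[of 0]
  proof eventually_elim
    case (elim r)
    then have "exp (ln (real r)) = real r" by simp
    then show ?case using elim by (simp add: field_simps)
  qed
qed

lemma wave_P_bigo:
  assumes "unavoidable k \<pi> e" "inj_on \<pi> {1..k}"
  shows "(\<lambda>r. real (wave_P k \<pi> r)) \<in> O[at_top](\<lambda>r. real r * ln (real r) ^ e)"
proof -
  obtain C where C: "1 \<le> C" "\<And>L n. 1 \<le> L \<Longrightarrow> n < 2 ^ L \<Longrightarrow> wave_g k \<pi> n < C * L ^ e"
    using wave_g_dyadic[OF assms] by blast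
  have "\<forall>\<^sub>F r :: nat in at_top.
      norm (real (wave_P k \<pi> r)) \<le> (real C * 8 ^ e) * norm (real r * ln (real r) ^ e)"
    using eventually_ln_power_le[of "real C * 8 ^ e" e] eventually_ge_at_top[of 2]
  proof eventually_elim
    case (elim r)
    have "2 \<le> real r" using elim by simp
    \<comment> \<open>The length \<open>L\<close> is taken for \<open>r ^ 2\<close>: the candidate
      \<open>M = r * (C * L ^ e)\<close> is eventually at most \<open>r ^ 2\<close>, hence below
      \<open>2 ^ L\<close>, and then \<open>wave_g\<close> at \<open>M\<close> is less than
      \<open>M / r\<close>.\<close>
    have "2 \<le> real r ^ 2"
      using mult_mono[OF \<open>2 \<le> real r\<close> \<open>2 \<le> real r\<close>] by (simp add: power2_eq_square)
    from ex_dyadic_length[OF this]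
    obtain L where L: "1 \<le> L" "real r ^ 2 < 2 ^ L" "real L \<le> 4 * ln (real r ^ 2)" by blast
    have "ln (real r ^ 2) = 2 * ln (real r)" using elim by (simp add: ln_realpow)
    then have "real L \<le> 8 * ln (real r)" using L(3) by simp
    then have "real C * real L ^ e \<le> real C * (8 * ln (real r)) ^ e"
      by (intro mult_left_mono power_mono) auto
    then have CL: "real (C * L ^ e) \<le> real C * 8 ^ e * ln (real r) ^ e"
      by (simp add: power_mult_distrib mult_ac)
    define M where "M = r * (C * L ^ e)"
    have "real M = real r * real (C * L ^ e)" by (simp add: M_def)
    also have "\<dots> \<le> real r * real r"
      using CL elim(1) by (intro mult_left_mono) auto
    finally have "real M < 2 ^ L" using L(2) unfolding power2_eq_square by linarith
    then have "M < 2 ^ L" by (metis of_nat_less_iff of_nat_numeral of_nat_power)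
    then have "wave_g k \<pi> M < C * L ^ e" using C(2)[OF L(1)] by blast
    then have "r * wave_g k \<pi> M < M" unfolding M_def using elim by simp
    then have "forces_wave k \<pi> r M" "0 < M" using forces_wave_density by auto
    then have "wave_P k \<pi> r \<le> M" unfolding wave_P_def by (intro Least_le) auto
    then have "real (wave_P k \<pi> r) \<le> real M" by simp
    also have "real M = real r * real (C * L ^ e)" by (simp add: M_def)
    also have "\<dots> \<le> real r * (real C * 8 ^ e * ln (real r) ^ e)"
      using CL by (intro mult_left_mono) auto
    finally show ?case using elim by (simp add: mult_ac)
  qed
  then show ?thesis by (rule bigoI)
qed

section \<open>Lower bounds from sets with prescribed residues\<close>

lemma ex_sixteen_power:
  assumes "1 \<le> k" "0 < n" "8 * real k \<le> ln (real n)"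
  shows "\<exists>m\<ge>1. 16 ^ (k * m) \<le> n \<and> ln (real n) / (8 * real k) \<le> real m"
proof -
  \<comment> \<open>As \<open>ln 16 \<le> 4\<close>, any \<open>m \<le> t\<close> gives
    \<open>16 ^ (k * m) \<le> n\<close>; rounding down costs at most half because
    \<open>2 \<le> t\<close>.\<close>
  define t where "t = ln (real n) / (4 * real k)"
  have t: "2 \<le> t" using assms by (simp add: t_def field_simps)
  define m where "m = nat \<lfloor>t\<rfloor>"
  have m: "real m = of_int \<lfloor>t\<rfloor>" using t by (simp add: m_def)
  then have m1: "1 \<le> m" "real m \<le> t" "t / 2 \<le> real m" using t by linarith+
  have "ln (16 :: real) = 4 * ln 2" using ln_realpow[of "2 :: real" 4] by simp
  then have "ln (16 :: real) \<le> 4" using ln_le_minus_one[of "2 :: real"] by simp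
  then have "real (k * m) * ln 16 \<le> real (k * m) * 4" by (intro mult_left_mono) auto
  also have "\<dots> \<le> 4 * real k * t" using m1(2) assms(1) by simp
  also have "\<dots> = ln (real n)" using assms(1) by (simp add: t_def)
  finally have "ln (16 ^ (k * m)) \<le> ln (real n)" by (simp add: ln_realpow)
  then have "(16 :: real) ^ (k * m) \<le> real n" using assms(2) by simp
  then have "16 ^ (k * m) \<le> n" by (metis of_nat_le_iff of_nat_numeral of_nat_power)
  moreover have "ln (real n) / (8 * real k) \<le> real m" using m1(3) by (simp add: t_def)
  ultimately show ?thesis using m1(1) by blast
qed

lemma eventually_le_ln: "\<forall>\<^sub>F n :: nat in at_top. K \<le> ln (real n)"
proof -
  have "filterlim (\<lambda>n :: nat. ln (real n)) at_top at_top"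
    by (rule filterlim_compose[OF ln_at_top filterlim_real_sequentially])
  then show ?thesis by (simp add: filterlim_at_top)
qed

text \<open>With \<open>q = m ^ k\<close> and all residues modulo \<open>q\<close> prescribed, the
  wave-free set has at least \<open>m ^ k\<close> elements. Its span is at most
  \<open>4 ^ (k * m) * 4 ^ (k * m)\<close>, whence the base 16.\<close>

lemma wave_g_lower:
  assumes "inj_on \<pi> {1..Suc k}" "\<nexists>i. is_peak (Suc k) \<pi> i" "1 \<le> m" "16 ^ (Suc k * m) \<le> n"
  shows "m ^ k \<le> wave_g (Suc k) \<pi> n"
proof -
  define q where "q = int (m ^ k)"
  have q: "0 < q" using assms(3) by (simp add: q_def)
  obtain A where A: "A \<subseteq> {0..<q * 4 ^ (k * m)}" "\<not> contains_wave (Suc k) \<pi> A"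
    "\<And>i. i < m ^ k \<Longrightarrow> \<exists>a\<in>A. a mod q = int i mod q"
    using wave_free_residues[OF assms(1,2) q assms(3)] by blast
  have fin: "finite A" using A(1) finite_subset by blast
  have "m ^ k \<le> 4 ^ (k * m)"
  proof -
    have "m \<le> 4 ^ m" using less_exp[of m] power_mono[of "2 :: nat" 4 m] by linarith
    then have "m ^ k \<le> (4 ^ m) ^ k" by (rule power_mono) simp
    then show ?thesis by (simp add: power_mult[symmetric] mult.commute)
  qed
  then have "q \<le> 4 ^ (k * m)" unfolding q_def by (metis of_nat_le_iff of_nat_numeral of_nat_power)
  then have "q * 4 ^ (k * m) \<le> 4 ^ (k * m) * 4 ^ (k * m)" by (intro mult_right_mono) auto
  also have "\<dots> = 16 ^ (k * m)" by (simp add: power_mult_distrib[symmetric])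
  also have "\<dots> \<le> 16 ^ (Suc k * m)" by (intro power_increasing) auto
  also have "\<dots> \<le> int n" using assms(4) by (metis of_nat_le_iff of_nat_numeral of_nat_power)
  finally have n: "q * 4 ^ (k * m) \<le> int n" .
  have "\<not> contains_wave (Suc k) \<pi> ((\<lambda>a. a + 1) ` A)" using A(2) contains_wave_translate by blast
  moreover have "(\<lambda>a. a + 1) ` A \<subseteq> {1..int n}" using A(1) n by fastforce
  ultimately have "card ((\<lambda>a. a + 1) ` A) \<le> wave_g (Suc k) \<pi> n" by (intro card_le_wave_g)
  then have "card A \<le> wave_g (Suc k) \<pi> n" by (simp add: card_image)
  moreover have "m ^ k \<le> card A"
  proof -
    have "int ` {..<m ^ k} \<subseteq> (\<lambda>a. a mod q) ` A"
    proof
      fix y assume "y \<in> int ` {..<m ^ k}"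
      then obtain i where i: "i < m ^ k" "y = int i" by auto
      then obtain a where "a \<in> A" "a mod q = int i mod q" using A(3) by blast
      moreover have "int i mod q = int i" using i by (simp add: q_def)
      ultimately show "y \<in> (\<lambda>a. a mod q) ` A" using i by force
    qed
    then have "card (int ` {..<m ^ k}) \<le> card ((\<lambda>a. a mod q) ` A)" using fin by (intro card_mono) auto
    also have "\<dots> \<le> card A" using fin by (rule card_image_le)
    finally show ?thesis by (simp add: card_image)
  qed
  ultimately show ?thesis by linarith
qed

text \<open>A wave-free set that meets every residue class modulo \<open>q\<close> and lies in
  \<open>{0..<q * R}\<close> has translates by multiples of \<open>q\<close> covering
  \<open>{1..q * R}\<close>. Only \<open>2 * R\<close> translates are needed, fewer than
  \<open>r\<close>, and each serves as a colour class.\<close>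

lemma wave_P_lower:
  assumes inj: "inj_on \<pi> {1..Suc k}" and ex: "\<exists>M>0. forces_wave (Suc k) \<pi> r M"
    and peak: "\<nexists>i. is_peak (Suc k) \<pi> i" and m: "1 \<le> m" "16 ^ (Suc k * m) \<le> r"
  shows "m ^ k * (r div 4) \<le> wave_P (Suc k) \<pi> r"
proof -
  define q where "q = int (m ^ k)"
  define R where "R = r div 4"
  have q: "0 < q" using m(1) by (simp add: q_def)
  obtain A where A: "A \<subseteq> {0..<q * 4 ^ (k * m)}" "\<not> contains_wave (Suc k) \<pi> A"
    "\<And>i. i < m ^ k \<Longrightarrow> \<exists>a\<in>A. a mod q = int i mod q"
    using wave_free_residues[OF inj peak q m(1)] by blast
  have "4 * 4 ^ (k * m) \<le> (4 :: nat) ^ (Suc k * m)"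
    using m(1) power_increasing[of "Suc (k * m)" "Suc k * m" "4 :: nat"] by simp
  also have "\<dots> \<le> 16 ^ (Suc k * m)" by (rule power_mono) auto
  also have "\<dots> \<le> r" by (rule m(2))
  finally have R: "4 ^ (k * m) \<le> R" by (simp add: R_def)
  then have R1: "1 \<le> R" using one_le_power[of "4 :: nat" "k * m"] by linarith
  have "4 ^ (k * m) \<le> int R" using R by (metis of_nat_le_iff of_nat_numeral of_nat_power)
  then have "q * 4 ^ (k * m) \<le> q * int R" using q by simp
  then have AR: "0 \<le> a \<and> a < q * int R" if "a \<in> A" for a using A(1) that by fastforce
  have "\<exists>a\<in>A. q dvd y - a" for y
  proof -
    have "nat (y mod q) < m ^ k" using q pos_mod_bound[OF q, of y] unfolding q_def by linarith
    from A(3)[OF this] obtain a where "a \<in> A" "a mod q = int (nat (y mod q)) mod q" by blast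
    then have "y mod q = a mod q" using q by simp
    then show ?thesis using \<open>a \<in> A\<close> by (auto simp: mod_eq_dvd_iff)
  qed
  then obtain \<alpha> where \<alpha>: "\<And>y. \<alpha> y \<in> A" "\<And>y. q dvd y - \<alpha> y" by metis
  \<comment> \<open>The colour is the index of the translate, shifted by \<open>R\<close> to be
    nonnegative on the interval.\<close>
  define c where "c y = nat ((y - \<alpha> y) div q + int R)" for y
  have c: "y = \<alpha> y + q * (int (c y) - int R) \<and> c y < r" if "y \<in> {1..int (m ^ k * R)}" for y
  proof -
    obtain s where s: "y - \<alpha> y = q * s" using \<alpha>(2) by (auto elim: dvdE)
    have "q * (- int R) < q * s" "q * s \<le> q * int R"
      using AR[OF \<alpha>(1)[of y]] s that by (auto simp: q_def)
    then have "- int R < s" "s \<le> int R" using q by (auto simp only: mult_less_cancel_left_pos mult_le_cancel_left_pos)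
    moreover have "(y - \<alpha> y) div q = s" using s q by simp
    ultimately have "int (c y) = s + int R" "s + int R \<le> 2 * int R" by (auto simp: c_def)
    moreover have "2 * R < r" using R1 by (simp add: R_def)
    ultimately show ?thesis using s by auto
  qed
  have "\<not> forces_wave (Suc k) \<pi> r (m ^ k * R)"
  proof
    assume "forces_wave (Suc k) \<pi> r (m ^ k * R)"
    moreover have "c ` {1..int (m ^ k * R)} \<subseteq> {..<r}" using c by blast
    ultimately obtain b where "contains_wave (Suc k) \<pi> {y \<in> {1..int (m ^ k * R)}. c y = b}"
      unfolding forces_wave_def by blast
    moreover have "{y \<in> {1..int (m ^ k * R)}. c y = b} \<subseteq> (\<lambda>a. a + q * (int b - int R)) ` A"
      using c \<alpha>(1) by blast
    ultimately show False using A(2) contains_wave_subset contains_wave_translate by blast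
  qed
  moreover have "forces_wave (Suc k) \<pi> r (wave_P (Suc k) \<pi> r)"
    unfolding wave_P_def using LeastI_ex[OF ex] by blast
  \<comment> \<open>If \<open>wave_P\<close> were at most \<open>m ^ k * R\<close>, monotonicity
    would make that length forcing as well.\<close>
  ultimately show ?thesis using forces_wave_mono unfolding R_def by (meson nat_le_linear)
qed

lemma wave_g_bigomega:
  assumes "inj_on \<pi> {1..Suc k}" "\<nexists>i. is_peak (Suc k) \<pi> i"
  shows "(\<lambda>n. real (wave_g (Suc k) \<pi> n)) \<in> \<Omega>[at_top](\<lambda>n. ln (real n) ^ k)"
proof -
  define d where "d = 8 * real (Suc k)"
  have d: "0 < d" by (simp add: d_def)
  have "\<forall>\<^sub>F n :: nat in at_top.
      norm (real (wave_g (Suc k) \<pi> n)) \<ge> (1 / d) ^ k * norm (ln (real n) ^ k)"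
    using eventually_le_ln[of d] eventually_gt_at_top[of 0]
  proof eventually_elim
    case (elim n)
    obtain m where m: "1 \<le> m" "16 ^ (Suc k * m) \<le> n" "ln (real n) / d \<le> real m"
      using ex_sixteen_power[of "Suc k" n] elim unfolding d_def by auto
    have "(ln (real n) / d) ^ k \<le> real m ^ k" using m(3) elim d by (intro power_mono) auto
    also have "\<dots> \<le> real (wave_g (Suc k) \<pi> n)"
      using wave_g_lower[OF assms m(1,2)] by (metis of_nat_le_iff of_nat_power)
    finally show ?case using elim d by (simp add: power_divide)
  qed
  then show ?thesis using d by (intro landau_omega.bigI[of "(1 / d) ^ k"]) auto
qed

lemma wave_P_bigomega:
  assumes "inj_on \<pi> {1..Suc k}" "\<And>r. \<exists>M>0. forces_wave (Suc k) \<pi> r M" "\<nexists>i. is_peak (Suc k) \<pi> i"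
  shows "(\<lambda>r. real (wave_P (Suc k) \<pi> r)) \<in> \<Omega>[at_top](\<lambda>r. real r * ln (real r) ^ k)"
proof -
  define d where "d = 8 * real (Suc k)"
  have d: "0 < d" by (simp add: d_def)
  have "\<forall>\<^sub>F r :: nat in at_top.
      norm (real (wave_P (Suc k) \<pi> r)) \<ge> (1 / d) ^ k / 8 * norm (real r * ln (real r) ^ k)"
    using eventually_le_ln[of d] eventually_ge_at_top[of 4]
  proof eventually_elim
    case (elim r)
    obtain m where m: "1 \<le> m" "16 ^ (Suc k * m) \<le> r" "ln (real r) / d \<le> real m"
      using ex_sixteen_power[of "Suc k" r] elim unfolding d_def by auto
    \<comment> \<open>For \<open>r \<ge> 4\<close> rounding down in \<open>r div 4\<close> loses at
      most a factor 2, whence the constant 8.\<close>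
    have "r = 4 * (r div 4) + r mod 4" "r mod 4 < 4" "1 \<le> r div 4" using elim(2) by auto
    then have "r \<le> 8 * (r div 4)" by linarith
    then have "real r / 8 \<le> real (r div 4)" by linarith
    moreover have "(ln (real r) / d) ^ k \<le> real m ^ k" using m(3) elim d by (intro power_mono) auto
    ultimately have "(ln (real r) / d) ^ k * (real r / 8) \<le> real m ^ k * real (r div 4)"
      by (intro mult_mono) auto
    also have "\<dots> = real (m ^ k * (r div 4))" by simp
    also have "\<dots> \<le> real (wave_P (Suc k) \<pi> r)"
      using wave_P_lower[OF assms m(1,2)] by (rule of_nat_mono)
    finally show ?case using elim d by (simp add: power_divide mult_ac)
  qed
  then show ?thesis using d by (intro landau_omega.bigI[of "(1 / d) ^ k / 8"]) auto
qed

theorem theorem1p14: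
  fixes k :: nat and \<pi> :: "nat \<Rightarrow> nat"
  assumes "1 \<le> k" and "\<pi> permutes {1..k}"
  shows "((\<nexists>i. is_peak k \<pi> i) \<longrightarrow>
            (\<lambda>n. real (wave_g k \<pi> n)) \<in> \<Theta>[at_top](\<lambda>n. ln (real n) ^ (k - 1)) \<and>
            (\<lambda>r. real (wave_P k \<pi> r)) \<in> \<Theta>[at_top](\<lambda>r. real r * ln (real r) ^ (k - 1))) \<and>
         ((\<exists>i. is_peak k \<pi> i) \<longrightarrow>
            (\<lambda>n. real (wave_g k \<pi> n)) \<in> O[at_top](\<lambda>n. ln (real n) ^ (k - 2)) \<and>
            (\<lambda>r. real (wave_P k \<pi> r)) \<in> O[at_top](\<lambda>r. real r * ln (real r) ^ (k - 2)))"
proof -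
  obtain h where h: "k = Suc h" using assms(1) by (cases k) auto
  have inj: "inj_on \<pi> {1..k}" using assms(2) by (rule permutes_inj_on)
  have inj': "inj_on \<pi> {1..Suc h}" using inj h by simp
  have ex: "\<exists>M>0. forces_wave (Suc h) \<pi> r M" for r
    using ex_forces_wave[OF assms] unfolding h .
  show ?thesis
  proof (intro conjI impI)
    assume peak: "\<nexists>i. is_peak k \<pi> i"
    note un = unavoidable_general[OF inj']
    note peak' = peak[unfolded h]
    show "(\<lambda>n. real (wave_g k \<pi> n)) \<in> \<Theta>[at_top](\<lambda>n. ln (real n) ^ (k - 1))"
      unfolding h using wave_g_bigo[OF un inj'] wave_g_bigomega[OF inj' peak']
      by (intro bigthetaI) simp_all
    show "(\<lambda>r. real (wave_P k \<pi> r)) \<in> \<Theta>[at_top](\<lambda>r. real r * ln (real r) ^ (k - 1))"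
      unfolding h using wave_P_bigo[OF un inj'] wave_P_bigomega[OF inj' ex peak']
      by (intro bigthetaI) simp_all
  next
    assume "\<exists>i. is_peak k \<pi> i"
    then obtain i where "is_peak k \<pi> i" ..
    note un = unavoidable_peak[OF inj this]
    show "(\<lambda>n. real (wave_g k \<pi> n)) \<in> O[at_top](\<lambda>n. ln (real n) ^ (k - 2))"
      using un inj by (rule wave_g_bigo)
    show "(\<lambda>r. real (wave_P k \<pi> r)) \<in> O[at_top](\<lambda>r. real r * ln (real r) ^ (k - 2))"
      using un inj by (rule wave_P_bigo)
  qed
qed

end
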